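(* Let $\varepsilon\in(0,1)$ and $\alpha,\beta\in[0,\infty]$. Let $\mathbf D_\alpha$ be any quantum extension of the classical Rényi divergence $D_\alpha$, and let $D_\beta^{\varepsilon,\le,\mathbb M}$ be the measured (minimal) quantum extension of the classical Rényi divergence $D_\beta^{\varepsilon,\le}$ smoothed over subnormalized vectors. Define $$\mu_{\mathrm{sub}}(\varepsilon,\alpha,\beta):=\sup_A\sup_{\rho,\sigma\in\mathfrak D(A)}\Big\{D_\beta^{\varepsilon,\le,\mathbb M}(\rho\|\sigma)-\mathbf D_\alpha(\rho\|\sigma)\Big\},$$ where the supremum is over all finite-dimensional systems $A$; i.e. $\mu_{\mathrm{sub}}(\varepsilon,\alpha,\beta)$ is the smallest number such that $D_\beta^{\varepsilon,\le,\mathbb M}(\rho\|\sigma)\le\mathbf D_\alpha(\rho\|\sigma)+\mu_{\mathrm{sub}}(\varepsilon,\alpha,\beta)$ for all finite-dimensional $A$ and all $\rho,\sigma\in\mathfrak D(A)$. Let $h_2(\theta):=-\theta\log\theta-(1-\theta)\log(1-\theta)$. Then: 1. If $\beta>\alpha>1$, then with $\theta:=\frac{\beta-\alpha}{\alpha(\beta-1)}$ (equal to $1/\alpha$ for $\beta=\infty$), $$\mu_{\mathrm{sub}}(\varepsilon,\alpha,\beta)=\begin{cases}\frac{\alpha}{\alpha-1}\left(\theta\log\frac1\varepsilon-h_2(\theta)\right)&\text{if }\varepsilon\le\theta,\\[2pt] \frac{\beta}{\beta-1}\log(1-\varepsilon)&\text{if }\varepsilon>\theta,\end{cases}$$ where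 $\frac{\beta}{\beta-1}=1$ for $\beta=\infty$. 2. If $0<\alpha<\beta<1$, then with $\theta:=\frac{\beta-\alpha}{\beta(1-\alpha)}$, $$\mu_{\mathrm{sub}}(\varepsilon,\alpha,\beta)=\max\left\{0,\ \frac{\beta}{1-\beta}\left(\theta\log\frac1\varepsilon-h_2(\theta)\right)\right\}.$$
   Context: $\log$ is base 2. $\mathrm{Prob}(d)$ is the set of $d$-dimensional probability vectors. Rényi divergence: for $\alpha\in(0,1)\cup(1,\infty)$, a nonnegative vector $\mathbf p\in\mathbb R_+^d$ with $\sum_xp_x\le1$, and $\mathbf q\in\mathrm{Prob}(d)$, $D_\alpha(\mathbf p\|\mathbf q)=\frac1{\alpha-1}\log\sum_x p_x^\alpha q_x^{1-\alpha}$ (the same formula is used for normalized and subnormalized $\mathbf p$, with no renormalization), equal to $\infty$ if $\alpha>1$ and $\mathrm{supp}(\mathbf p)\not\subseteq\mathrm{supp}(\mathbf q)$, or if $\alpha<1$ and the supports are disjoint; $D_\infty(\mathbf p\|\mathbf q)=\log\max_{x:p_x>0}p_x/q_x$. Subnormalized smoothing: for $\mathbf p,\mathbf q\in\mathrm{Prob}(d)$, $D_\beta^{\varepsilon,\le}(\mathbf p\|\mathbf q)=\inf\{D_\beta(\mathbf r\|\mathbf q):\mathbf r\in\mathbb R_+^d,\ \sum_xr_x\le1,\ \|\mathbf p-\mathbf r\|_+\le\varepsilon\}$, where $\|\mathbf p-\mathbf r\|_+=\sum_x\max\{p_x-r_x,0\}$. $\mathfrak{D}(A)$ is the set of density operators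 on a finite-dimensional Hilbert space $A$. A quantum divergence is a function $\mathbf D$ on pairs of density operators (in all finite dimensions) with values in $\mathbb R\cup\{\infty\}$ such that $\mathbf D(\mathcal E(\rho)\|\mathcal E(\sigma))\le\mathbf D(\rho\|\sigma)$ for every completely positive trace-preserving map $\mathcal E$. A quantum extension of a classical divergence $D$ is a quantum divergence that coincides with $D$ on commuting (simultaneously diagonal) states. The measured extension is $D_\beta^{\varepsilon,\le,\mathbb M}(\rho\|\sigma)=\sup_{\mathcal E}D_\beta^{\varepsilon,\le}(\mathcal E(\rho)\|\mathcal E(\sigma))$, the supremum running over all POVM measurement channels $\mathcal E$ from $A$ to a finite classical system $X$ (outputs regarded as probability vectors). *)

theory Defs
  imports
    "HOL-Library.Extended_Real"
    "Jordan_Normal_Form.Schur_Decomposition"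
begin

section \<open>Classical R\'enyi divergences\<close>

definition prob_vec :: "nat \<Rightarrow> real vec set" where
  "prob_vec d = {p \<in> carrier_vec d. (\<forall>x<d. 0 \<le> p $ x) \<and> (\<Sum>x<d. p $ x) = 1}"

definition subprob_vec :: "nat \<Rightarrow> real vec set" where
  "subprob_vec d = {p \<in> carrier_vec d. (\<forall>x<d. 0 \<le> p $ x) \<and> (\<Sum>x<d. p $ x) \<le> 1}"

definition supp_vec :: "real vec \<Rightarrow> nat set" where
  "supp_vec p = {x. x < dim_vec p \<and> p $ x \<noteq> 0}"

text \<open>
  The order ranges over the whole of \<open>[0, \<infinity>]\<close>.  At order \<open>0\<close> the general formula applies, because
  \<open>0 powr 0 = 0\<close> makes the sum run over the support of \<open>p\<close>; order \<open>1\<close> is the Kullback-Leibler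
  divergence.  The branch with value \<open>-\<infinity>\<close> is the convention \<open>log 0 = -\<infinity>\<close> for the zero vector, on
  which the library logarithm would return \<open>0\<close> and \<open>Max {}\<close> would be unspecified.
\<close>
definition renyi_div :: "ereal \<Rightarrow> real vec \<Rightarrow> real vec \<Rightarrow> ereal" where
  "renyi_div \<alpha> p q =
    (if 1 \<le> \<alpha> \<and> \<not> supp_vec p \<subseteq> supp_vec q \<or> \<alpha> < 1 \<and> supp_vec p \<inter> supp_vec q = {} then \<infinity>
     else if 1 < \<alpha> \<and> supp_vec p = {} then -\<infinity>
     else if \<alpha> = \<infinity> then ereal (log 2 (Max ((\<lambda>x. p $ x / q $ x) ` supp_vec p)))
     else if \<alpha> = 1 then ereal (\<Sum>x\<in>supp_vec p. p $ x * log 2 (p $ x / q $ x))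
     else let a = real_of_ereal \<alpha> in
       ereal (1 / (a - 1) * log 2 (\<Sum>x<dim_vec p. (p $ x) powr a * (q $ x) powr (1 - a))))"

definition smoothed_renyi_div :: "real \<Rightarrow> ereal \<Rightarrow> real vec \<Rightarrow> real vec \<Rightarrow> ereal" where
  "smoothed_renyi_div \<epsilon> \<beta> p q =
    (INF r \<in> {r \<in> subprob_vec (dim_vec p). (\<Sum>x<dim_vec p. max (p $ x - r $ x) 0) \<le> \<epsilon>}.
       renyi_div \<beta> r q)"


section \<open>States, channels and measurements\<close>

definition mtrace :: "complex mat \<Rightarrow> complex" where
  "mtrace A = (\<Sum>i<dim_row A. A $$ (i, i))"

text \<open>
  The order on \<^typ>\<open>complex\<close> is the one in which \<open>0 \<le> z\<close> says that \<open>z\<close> is real and nonnegative, so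
  Hermiticity of \<open>A\<close> is implied.
\<close>
definition psd_mat :: "nat \<Rightarrow> complex mat \<Rightarrow> bool" where
  "psd_mat n A \<longleftrightarrow> A \<in> carrier_mat n n \<and> (\<forall>v \<in> carrier_vec n. 0 \<le> (A *\<^sub>v v) \<bullet>c v)"

definition density :: "nat \<Rightarrow> complex mat set" where
  "density n = {\<rho>. psd_mat n \<rho> \<and> mtrace \<rho> = 1}"

text \<open>
  The map \<open>id\<^sub>k \<otimes> \<Phi>\<close>: a matrix on the tensor product of dimensions \<open>k\<close> and \<open>n\<close> is a \<open>k \<times> k\<close> array
  of \<open>n \<times> n\<close> blocks, and \<open>\<Phi>\<close> is applied to each block.
\<close>
definition ampliation ::
    "nat \<Rightarrow> nat \<Rightarrow> nat \<Rightarrow> (complex mat \<Rightarrow> complex mat) \<Rightarrow> complex mat \<Rightarrow> complex mat" where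
  "ampliation k n m \<Phi> X =
    mat (k * m) (k * m) (\<lambda>(i, j).
      \<Phi> (mat n n (\<lambda>(a, b). X $$ ((i div m) * n + a, (j div m) * n + b))) $$ (i mod m, j mod m))"

definition cptp :: "nat \<Rightarrow> nat \<Rightarrow> (complex mat \<Rightarrow> complex mat) \<Rightarrow> bool" where
  "cptp n m \<Phi> \<longleftrightarrow>
    (\<forall>A \<in> carrier_mat n n. \<Phi> A \<in> carrier_mat m m) \<and>
    (\<forall>A \<in> carrier_mat n n. \<forall>B \<in> carrier_mat n n. \<Phi> (A + B) = \<Phi> A + \<Phi> B) \<and>
    (\<forall>A \<in> carrier_mat n n. \<forall>c. \<Phi> (c \<cdot>\<^sub>m A) = c \<cdot>\<^sub>m \<Phi> A) \<and>
    (\<forall>k X. psd_mat (k * n) X \<longrightarrow> psd_mat (k * m) (ampliation k n m \<Phi> X)) \<and>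
    (\<forall>A \<in> carrier_mat n n. mtrace (\<Phi> A) = mtrace A)"

definition unitary_mat :: "nat \<Rightarrow> complex mat \<Rightarrow> bool" where
  "unitary_mat n U \<longleftrightarrow> U \<in> carrier_mat n n \<and> mat_adjoint U * U = 1\<^sub>m n"

definition povm :: "nat \<Rightarrow> nat \<Rightarrow> (nat \<Rightarrow> complex mat) \<Rightarrow> bool" where
  "povm n m M \<longleftrightarrow>
    (\<forall>x<m. psd_mat n (M x)) \<and> mat n n (\<lambda>ij. \<Sum>x<m. M x $$ ij) = 1\<^sub>m n"

definition measure_povm :: "nat \<Rightarrow> (nat \<Rightarrow> complex mat) \<Rightarrow> complex mat \<Rightarrow> real vec" where
  "measure_povm m M \<rho> = vec m (\<lambda>x. Re (mtrace (M x * \<rho>)))"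


section \<open>Quantum divergences\<close>

definition quantum_divergence :: "(complex mat \<Rightarrow> complex mat \<Rightarrow> ereal) \<Rightarrow> bool" where
  "quantum_divergence D \<longleftrightarrow>
    (\<forall>n. \<forall>\<rho> \<in> density n. \<forall>\<sigma> \<in> density n. D \<rho> \<sigma> \<noteq> -\<infinity>) \<and>
    (\<forall>n m \<Phi>. cptp n m \<Phi> \<longrightarrow>
      (\<forall>\<rho> \<in> density n. \<forall>\<sigma> \<in> density n. D (\<Phi> \<rho>) (\<Phi> \<sigma>) \<le> D \<rho> \<sigma>))"

text \<open>The matrix \<open>U diag(p) U\<^sup>*\<close>.\<close>
definition diag_state :: "complex mat \<Rightarrow> real vec \<Rightarrow> complex mat" where
  "diag_state U p = U * mat_diag (dim_vec p) (\<lambda>x. complex_of_real (p $ x)) * mat_adjoint U"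

definition quantum_extension ::
    "(real vec \<Rightarrow> real vec \<Rightarrow> ereal) \<Rightarrow> (complex mat \<Rightarrow> complex mat \<Rightarrow> ereal) \<Rightarrow> bool" where
  "quantum_extension Dc D \<longleftrightarrow>
    quantum_divergence D \<and>
    (\<forall>n U. unitary_mat n U \<longrightarrow>
      (\<forall>p \<in> prob_vec n. \<forall>q \<in> prob_vec n. D (diag_state U p) (diag_state U q) = Dc p q))"

definition measured_div ::
    "(real vec \<Rightarrow> real vec \<Rightarrow> ereal) \<Rightarrow> complex mat \<Rightarrow> complex mat \<Rightarrow> ereal" where
  "measured_div Dc \<rho> \<sigma> =
    (SUP (m, M) \<in> {(m, M). povm (dim_row \<rho>) m M}. Dc (measure_povm m M \<rho>) (measure_povm m M \<sigma>))"

text \<open>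
  Pairs with \<open>D \<rho> \<sigma> = \<infinity>\<close> are left out because the difference may be \<open>\<infinity> - \<infinity>\<close> there, which is
  \<open>\<infinity>\<close> in \<^typ>\<open>ereal\<close>.  They impose no constraint on the optimal constant, which is what the
  supremum stands for; this is \<open>mu_sub_le_iff\<close> below.
\<close>
definition mu_sub :: "real \<Rightarrow> ereal \<Rightarrow> (complex mat \<Rightarrow> complex mat \<Rightarrow> ereal) \<Rightarrow> ereal" where
  "mu_sub \<epsilon> \<beta> D =
    (SUP (\<rho>, \<sigma>) \<in> {(\<rho>, \<sigma>). (\<exists>n. \<rho> \<in> density n \<and> \<sigma> \<in> density n) \<and> D \<rho> \<sigma> \<noteq> \<infinity>}.
       measured_div (smoothed_renyi_div \<epsilon> \<beta>) \<rho> \<sigma> - D \<rho> \<sigma>)"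

lemma mu_sub_le_iff:
  assumes "quantum_divergence D"
  shows "mu_sub \<epsilon> \<beta> D \<le> \<mu> \<longleftrightarrow>
    (\<forall>n. \<forall>\<rho> \<in> density n. \<forall>\<sigma> \<in> density n.
       measured_div (smoothed_renyi_div \<epsilon> \<beta>) \<rho> \<sigma> \<le> D \<rho> \<sigma> + \<mu>)"
proof -
  let ?M = "measured_div (smoothed_renyi_div \<epsilon> \<beta>)"
  have *: "(D \<rho> \<sigma> \<noteq> \<infinity> \<longrightarrow> ?M \<rho> \<sigma> - D \<rho> \<sigma> \<le> \<mu>) \<longleftrightarrow> ?M \<rho> \<sigma> \<le> D \<rho> \<sigma> + \<mu>"
    if "\<rho> \<in> density n" "\<sigma> \<in> density n" for n \<rho> \<sigma>
  proof -
    have "D \<rho> \<sigma> \<noteq> -\<infinity>"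
      using assms that unfolding quantum_divergence_def by blast
    then show ?thesis
      by (cases "D \<rho> \<sigma>") (auto simp: ereal_minus_le add.commute)
  qed
  have "mu_sub \<epsilon> \<beta> D \<le> \<mu> \<longleftrightarrow>
    (\<forall>\<rho> \<sigma> n. \<rho> \<in> density n \<and> \<sigma> \<in> density n \<longrightarrow> (D \<rho> \<sigma> \<noteq> \<infinity> \<longrightarrow> ?M \<rho> \<sigma> - D \<rho> \<sigma> \<le> \<mu>))"
    unfolding mu_sub_def by (auto simp: SUP_le_iff)
  then show ?thesis
    using * by blast
qed

definition h2 :: "real \<Rightarrow> real" where
  "h2 \<theta> = - \<theta> * log 2 \<theta> - (1 - \<theta>) * log 2 (1 - \<theta>)"

end

theory Submission
  imports Defs "HOL-Analysis.Convex"
begin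

text \<open>
  A measurement channel is completely positive and trace preserving, so a quantum extension dominates
  the classical divergence of the outcome distributions; since it agrees with the classical divergence
  on diagonal states, the problem reduces to probability vectors \<open>p\<close>, \<open>q\<close>.

  For \<open>\<alpha> > 1\<close> the smoothing is \<open>r = min p (c q)\<close> with \<open>c\<close> chosen so that exactly the mass \<open>\<epsilon>\<close> is removed.
  Every summand of the \<open>\<beta>\<close>-sum is then bounded by a tangent, at the optimal likelihood ratio, that is
  affine in the removed mass and in the summand of the \<open>\<alpha>\<close>-sum.  The extremal pair is
  \<open>p = (1 - w, w)\<close>, \<open>q = (1 - \<delta>, \<delta>)\<close> with \<open>\<delta> \<rightarrow> 0\<close>.

  For \<open>\<beta> < 1\<close> the smoothing raises \<open>p\<close> to \<open>c q\<close> where the likelihood ratio is small and lowers it where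
  the ratio is large.  The lowering is controlled by splitting \<open>q powr (1 - \<alpha>)\<close> into a multiple of
  \<open>r powr (1 - \<alpha>)\<close> and a remainder that vanishes wherever mass was removed.  The extremal pairs are
  \<open>p = (1 - x, x)\<close>, \<open>q = (0, 1)\<close>.
\<close>

section \<open>Tangent inequalities for real powers\<close>

text \<open>The parameters come from optimising over the extremal pairs. For
  \<open>\<alpha> > 1\<close> such a pair yields
  \<open>c * log 2 (w - \<epsilon>) - a / (a - 1) * log 2 w\<close>; since
  \<open>c = a / (a - 1) * (1 - \<theta>)\<close>, this is stationary at
  \<open>w = \<epsilon> / \<theta>\<close>, where the fraction \<open>\<theta>\<close> of the weight
  \<open>w\<close> is removed. This \<open>w\<close> is a probability only if
  \<open>\<epsilon> \<le> \<theta>\<close>; otherwise the best choice is \<open>w = 1\<close>, hence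
  the two cases. For \<open>\<beta> < 1\<close> the stationary point is
  \<open>x = \<epsilon> * (1 - \<theta>) / \<theta>\<close>, where the added mass is the fraction
  \<open>\<theta>\<close> of the filled value, and \<open>x = 1\<close> supplies the alternative 0.
  The tangents touch at exactly these ratios, and the unknown level \<open>c\<close> drops out by
  homogeneity. The obstacle below order 1 is that filling alone produces total mass
  \<open>1 + \<epsilon>\<close>. Mass has to be taken away again, which can lower the
  \<open>\<beta>\<close>-sum, so the bound for the filled vector does not carry over directly. Above
  order 1 there is no such conflict: subnormalised vectors are allowed and the cut mass is simply
  lost.\<close>

lemma powr_le_tangent:
  fixes a x :: real
  assumes "0 \<le> a" "a \<le> 1" "0 \<le> x"
  shows "x powr a \<le> 1 + a * (x - 1)"
proof (cases "x = 0")
  case False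
  then show ?thesis
    using Youngs_inequality_0[of a "1 - a" x 1] assms by (simp add: algebra_simps)
qed (use assms in auto)

text \<open>Bernoulli's inequality for a real exponent: the concave case with exponent
  \<open>1 / a\<close>, at the point \<open>x powr a\<close>, gives the convex one.\<close>

lemma powr_ge_tangent:
  fixes a x :: real
  assumes "1 \<le> a" "0 \<le> x"
  shows "1 + a * (x - 1) \<le> x powr a"
proof -
  have "x = (x powr a) powr (1 / a)"
    using assms by (simp add: powr_powr)
  also have "\<dots> \<le> 1 + (1 / a) * (x powr a - 1)"
    using assms by (intro powr_le_tangent) auto
  finally have "a * x \<le> a * (1 + (1 / a) * (x powr a - 1))"
    using assms by (intro mult_left_mono) auto
  also have "\<dots> = a + (x powr a - 1)"
    using assms by (simp add: algebra_simps)
  finally show ?thesis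
    by (simp add: algebra_simps)
qed

text \<open>Here \<open>u\<close> stands for \<open>p / (c * q)\<close>, so
  \<open>min 1 (1 / u)\<close> is the retained fraction of \<open>p\<close>. For
  \<open>u \<ge> 1\<close> the bound is, up to the factor \<open>1 / u\<close>, the tangent of
  \<open>x powr a\<close> at \<open>x = (1 - t) * u = 1\<close>; equality holds where exactly the
  fraction \<open>t\<close> is cut off. The last assumption is what the bound demands as
  \<open>u\<close> tends to 0.\<close>

lemma truncation_pointwise:
  fixes a b k t u :: real
  assumes "1 < a" "a < b" "0 < u" "0 < t" "t < 1"
    and k: "k = (b - 1) / (a - 1)" and t: "(1 - t) * (k - 1) \<le> b * t"
  shows "min 1 (1 / u) powr b * u powr (b - 1) + b * (1 - min 1 (1 / u) - t)
    \<le> (1 - t) * (1 - k + k * ((1 - t) * u) powr (a - 1))"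
proof -
  have ka: "k * (a - 1) = b - 1" and k1: "1 < k"
    using assms(1,2) by (simp_all add: k less_divide_eq)
  \<comment> \<open>The formula for cut points, valid for every positive \<open>u\<close>; its value
    at \<open>u = 1\<close> also serves the uncut points.\<close>
  have large: "1 / u + b * (1 - 1 / u - t)
    \<le> (1 - t) * (1 - k + k * ((1 - t) * u) powr (a - 1))" if "0 < u" for u
  proof -
    define x where "x = (1 - t) * u"
    have x: "0 < x" using that assms by (simp add: x_def)
    have "1 + b * (x - 1) = x + (b - 1) * (x - 1)"
      by (simp add: algebra_simps)
    also have "\<dots> = x * (1 - k) + k * (1 + a * (x - 1))"
      by (subst ka[symmetric]) (simp add: algebra_simps)
    also have "\<dots> \<le> x * (1 - k) + k * x powr a"
      using powr_ge_tangent[of a x] x k1 assms by (intro add_left_mono mult_left_mono) auto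
    also have "x powr a = x * x powr (a - 1)"
      using x by (simp add: powr_diff)
    finally have "(1 + b * (x - 1)) / u \<le> (x * (1 - k) + k * (x * x powr (a - 1))) / u"
      using that by (simp add: divide_right_mono)
    moreover have "(1 + b * (x - 1)) / u = 1 / u + b * (1 - 1 / u - t)"
      using that by (simp add: x_def field_simps)
    moreover have "(x * (1 - k) + k * (x * X)) / u = (1 - t) * (1 - k + k * X)" for X
      using that by (simp add: x_def field_simps)
    ultimately show ?thesis
      by (simp add: x_def)
  qed
  show ?thesis
  proof (cases "1 \<le> u")
    case True
    then have "min 1 (1 / u) = 1 / u" by simp
    moreover have "(1 / u) powr b * u powr (b - 1) = 1 / u"
      using assms by (simp add: powr_divide powr_diff)
    ultimately show ?thesis
      using large[of u] assms by simp
  next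
    case False
    \<comment> \<open>Once \<open>u powr (b - 1) = v powr k\<close> is bounded by \<open>v\<close>,
      both sides are affine in \<open>v\<close> between 0 and 1. The end point \<open>v = 0\<close>
      is the assumption on \<open>t\<close>, and \<open>v = 1\<close> is \<open>large\<close> at
      \<open>u = 1\<close>.\<close>
    define v where "v = u powr (a - 1)"
    have v: "0 \<le> v" "v \<le> 1"
      using False assms powr_mono2[of "a - 1" u 1] by (auto simp: v_def)
    have min1: "min 1 (1 / u) = 1"
      using False assms by simp
    have "u powr (b - 1) = v powr k"
      by (simp add: v_def powr_powr ka mult.commute)
    also have "\<dots> \<le> v powr 1"
      using powr_mono'[of 1 k v] v k1 by simp
    finally have le: "u powr (b - 1) \<le> v" using v by simp
    let ?w = "(1 - t) powr (a - 1)"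
    have "1 - b * t \<le> (1 - t) * (1 - k + k * ?w)"
      using large[of 1] by simp
    moreover have "0 - b * t \<le> (1 - t) * (1 - k)"
      using t by (simp add: algebra_simps)
    ultimately have "v * (1 - b * t) + (1 - v) * (0 - b * t)
      \<le> v * ((1 - t) * (1 - k + k * ?w)) + (1 - v) * ((1 - t) * (1 - k))"
      using v by (intro add_mono mult_left_mono) auto
    then have "v - b * t \<le> (1 - t) * (1 - k + k * (?w * v))"
      by (simp add: algebra_simps)
    then show ?thesis
      using le min1 assms by (simp add: v_def powr_mult)
  qed
qed

text \<open>The limit of the preceding inequality, divided by \<open>b\<close>, as \<open>b\<close>
  tends to infinity: the summand with exponent \<open>b\<close> disappears and only the removed mass
  remains on the left.\<close>

lemma truncation_pointwise_infinity:
  fixes a t u :: real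
  assumes "1 < a" "0 < u" "0 < t" "t < 1" and t: "1 - t \<le> t * (a - 1)"
  shows "1 - min 1 (1 / u) - t \<le> (1 - t) / (a - 1) * (((1 - t) * u) powr (a - 1) - 1)"
proof (cases "1 \<le> u")
  case True
  define x where "x = (1 - t) * u"
  have x: "0 < x" using assms by (simp add: x_def)
  have "(a - 1) * (x - 1) \<le> x powr a - x"
    using powr_ge_tangent[of a x] x assms by (simp add: algebra_simps)
  also have "x powr a = x * x powr (a - 1)"
    using x by (simp add: powr_diff)
  finally have "(x - 1) / u \<le> (x * x powr (a - 1) - x) / (a - 1) / u"
    using assms by (intro divide_right_mono) (auto simp: field_simps)
  moreover have "1 - 1 / u - t = (x - 1) / u"
    using assms by (simp add: x_def field_simps)
  moreover have "(x * x powr (a - 1) - x) / (a - 1) / u = (1 - t) / (a - 1) * (x powr (a - 1) - 1)"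
    using assms by (simp add: x_def field_simps)
  moreover have "min 1 (1 / u) = 1 / u" using True by simp
  ultimately show ?thesis by (simp add: x_def)
next
  case False
  then have "min 1 (1 / u) = 1" using assms by simp
  moreover have "- t \<le> (1 - t) / (a - 1) * (- 1)"
    using t assms by (simp add: field_simps)
  moreover have "(1 - t) / (a - 1) * (- 1) \<le> (1 - t) / (a - 1) * (((1 - t) * u) powr (a - 1) - 1)"
    using assms by (intro mult_left_mono) auto
  ultimately show ?thesis by simp
qed

text \<open>Again \<open>u\<close> is \<open>p / (c * q)\<close>. The value \<open>\<theta>\<close>
  is the one for which the tangent at \<open>u = 1 - \<theta>\<close> has slope \<open>b\<close> and
  cancels the slope of \<open>b * (1 - u)\<close>; the constants then add up to 1. So equality holds
  where filling supplies the fraction \<open>\<theta>\<close> of \<open>c * q\<close>.\<close>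

lemma filling_pointwise:
  fixes a b \<theta> u :: real
  assumes "0 < a" "a < b" "b < 1" "0 \<le> u"
    and k: "k = (1 - b) / (1 - a)" and \<theta>: "\<theta> = (b - a) / (b * (1 - a))"
  shows "b * max 0 (1 - u) + k * (u / (1 - \<theta>)) powr a \<le> max u 1 powr b"
proof -
  have th: "1 - \<theta> = a * (1 - b) / (b * (1 - a))"
    using assms(1-3) by (simp add: \<theta> field_simps)
  then have th0: "0 < 1 - \<theta>"
    using assms(1-3) by simp
  have k0: "0 < k" using assms by simp
  have kb: "k * a / (1 - \<theta>) = b" "k * (1 - a) = 1 - b"
    unfolding th k using assms(1-3) by (simp_all add: divide_simps)
  have small: "b * (1 - u) + k * (u / (1 - \<theta>)) powr a \<le> 1" if "0 \<le> u" for u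
  proof -
    have "k * (u / (1 - \<theta>)) powr a \<le> k * (1 + a * (u / (1 - \<theta>) - 1))"
      using that th0 k0 assms by (intro mult_left_mono powr_le_tangent) auto
    also have "\<dots> = k * (1 - a) + (k * a / (1 - \<theta>)) * u"
      by (simp add: algebra_simps)
    finally show ?thesis unfolding kb by (simp add: algebra_simps)
  qed
  show ?thesis
  proof (cases "u \<le> 1")
    case True
    then show ?thesis using small[of u] assms by (simp add: max_def)
  next
    case False
    \<comment> \<open>The case \<open>u = 1\<close> of \<open>small\<close> bounds the coefficient
      of \<open>u powr a\<close> by 1; raising the exponent from \<open>a\<close> to
      \<open>b\<close> only helps since \<open>u > 1\<close>.\<close>
    have "k * (u / (1 - \<theta>)) powr a = (k * (1 / (1 - \<theta>)) powr a) * u powr a"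
      using th0 assms by (simp add: powr_divide)
    also have "\<dots> \<le> 1 * u powr a"
      using small[of 1] by (intro mult_right_mono) auto
    also have "\<dots> \<le> u powr b"
      using False assms by (simp add: powr_mono)
    finally show ?thesis using False by (simp add: max_def)
  qed
qed

section \<open>Truncation from above\<close>

text \<open>Summing the pointwise bound with weights \<open>p\<close> gives an upper bound affine in
  the \<open>\<alpha>\<close>-sum; a second tangent, of \<open>y powr k\<close> at
  \<open>y = \<epsilon> / t\<close>, replaces it by a pure power, from which \<open>c\<close>
  cancels. Assumption \<open>e\<close> makes the constants combine for this. It holds for
  \<open>t = \<epsilon>\<close>, where both sides vanish, and for the \<open>t\<close> with
  \<open>(1 - t) * (k - 1) = b * t\<close>.\<close>

lemma truncated_renyi_sum_le:
  fixes p q :: "'i \<Rightarrow> real"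
  assumes "finite S" and p: "\<And>x. x \<in> S \<Longrightarrow> 0 \<le> p x" and q: "\<And>x. x \<in> S \<Longrightarrow> 0 < p x \<Longrightarrow> 0 < q x"
    and q0: "\<And>x. x \<in> S \<Longrightarrow> 0 \<le> q x"
    and sp: "sum p S = 1" and "0 < c" and sr: "(\<Sum>x\<in>S. min (p x) (c * q x)) = 1 - \<epsilon>"
    and "1 < a" "a < b" "0 < \<epsilon>" "\<epsilon> \<le> t" "t < 1"
    and k: "k = (b - 1) / (a - 1)" and t: "(1 - t) * (k - 1) \<le> b * t"
    and e: "(1 - t) * (k - 1) * (1 - \<epsilon> / t) = b * (t - \<epsilon>)"
  shows "(\<Sum>x\<in>S. min (p x) (c * q x) powr b * q x powr (1 - b))
    \<le> (1 - t) powr b * (\<epsilon> / t) powr (1 - k) * (\<Sum>x\<in>S. p x powr a * q x powr (1 - a)) powr k"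
proof -
  define r where "r x = min (p x) (c * q x)" for x
  define R where "R = (\<Sum>x\<in>S. r x powr b * q x powr (1 - b))"
  define Q where "Q = (\<Sum>x\<in>S. p x powr a * q x powr (1 - a))"
  \<comment> \<open>The \<open>\<alpha>\<close>-sum rescaled so that, at the extremal pair and in
    the limit, \<open>y\<close> equals the weight \<open>w = \<epsilon> / t\<close>.\<close>
  define y where "y = (1 - t) powr (a - 1) * c powr (1 - a) * Q"
  have ka: "k * (a - 1) = b - 1" and k1: "1 < k"
    using \<open>1 < a\<close> \<open>a < b\<close> by (simp_all add: k less_divide_eq)
  have t0: "0 < t" using assms by simp
  have pointwise: "c powr (1 - b) * (r x powr b * q x powr (1 - b)) + b * (p x - r x - t * p x)
      \<le> (1 - t) * (p x - k * p x + k * ((1 - t) powr (a - 1) * c powr (1 - a) * (p x powr a * q x powr (1 - a))))"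
    if x: "x \<in> S" for x
  proof (cases "p x = 0")
    case True
    then show ?thesis using q0[OF x] \<open>0 < c\<close> by (simp add: r_def)
  next
    case False
    then have px: "0 < p x" "0 < q x" using p[OF x] q[OF x] by auto
    define u where "u = p x / (c * q x)"
    have u: "0 < u" "q x = p x / (c * u)" using px \<open>0 < c\<close> by (auto simp: u_def)
    have r: "r x = p x * min 1 (1 / u)"
      using px \<open>0 < c\<close> u(1) by (auto simp: r_def u_def min_def field_simps)
    have 1: "c powr (1 - b) * (r x powr b * q x powr (1 - b)) = p x * (min 1 (1 / u) powr b * u powr (b - 1))"
      unfolding r using px u \<open>0 < c\<close> by (simp add: powr_mult powr_divide powr_diff)
    have 2: "c powr (1 - a) * (p x powr a * q x powr (1 - a)) = p x * u powr (a - 1)"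
      using px u \<open>0 < c\<close> by (simp add: powr_mult powr_divide powr_diff)
    have "p x * (min 1 (1 / u) powr b * u powr (b - 1) + b * (1 - min 1 (1 / u) - t))
      \<le> p x * ((1 - t) * (1 - k + k * ((1 - t) * u) powr (a - 1)))"
      using assms u px t0 by (intro mult_left_mono truncation_pointwise) auto
    also have "\<dots> = (1 - t) * (p x - k * p x + k * ((1 - t) powr (a - 1) * (p x * u powr (a - 1))))"
      unfolding powr_mult[of "1 - t" u "a - 1"] by (simp add: algebra_simps)
    finally show ?thesis
      unfolding 2[symmetric] using 1 r by (simp add: algebra_simps)
  qed
  have "c powr (1 - b) * R + b * (\<epsilon> - t) = (\<Sum>x\<in>S. c powr (1 - b) * (r x powr b * q x powr (1 - b)) + b * (p x - r x - t * p x))"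
    using sp sr by (simp add: R_def r_def sum.distrib sum_subtractf flip: sum_distrib_left)
  also have "\<dots> \<le> (\<Sum>x\<in>S. (1 - t) * (p x - k * p x + k * ((1 - t) powr (a - 1) * c powr (1 - a) * (p x powr a * q x powr (1 - a)))))"
    by (intro sum_mono pointwise)
  also have "\<dots> = (1 - t) * (1 - k + k * y)"
    using sp by (simp add: Q_def y_def sum.distrib sum_subtractf flip: sum_distrib_left)
  finally have "c powr (1 - b) * R \<le> (1 - t) * (k * y - (k - 1) * (\<epsilon> / t))"
    using e by (simp add: algebra_simps del: times_divide_eq_left times_divide_eq_right)
  also have "k * y - (k - 1) * (\<epsilon> / t) \<le> (\<epsilon> / t) powr (1 - k) * y powr k"
  proof -
    define s where "s = \<epsilon> / t"
    have s: "0 < s" using assms t0 by (simp add: s_def)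
    have y0: "0 \<le> y" by (auto simp: y_def Q_def intro!: sum_nonneg mult_nonneg_nonneg)
    have "s * (1 + k * (y / s - 1)) \<le> s * (y / s) powr k"
      using k1 s y0 by (intro mult_left_mono powr_ge_tangent) auto
    also have "\<dots> = s powr (1 - k) * y powr k"
      using s y0 by (simp add: powr_divide powr_diff)
    also have "s * (1 + k * (y / s - 1)) = k * y - (k - 1) * s"
      using s by (simp add: field_simps)
    finally show ?thesis unfolding s_def .
  qed
  finally have main: "c powr (b - 1) * (c powr (1 - b) * R)
      \<le> c powr (b - 1) * ((1 - t) * ((\<epsilon> / t) powr (1 - k) * y powr k))"
    using \<open>t < 1\<close> by (simp add: mult_left_mono)
  have yk: "y powr k = (1 - t) powr (b - 1) * c powr (1 - b) * Q powr k"
  proof -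
    have "k * (1 - a) = 1 - b" using ka by (simp add: algebra_simps)
    then show ?thesis using ka by (simp add: y_def powr_mult powr_powr mult.commute)
  qed
  have cc: "c powr (b - 1) * (c powr (1 - b) * X) = X" for X
    using \<open>0 < c\<close> by (simp flip: powr_add mult.assoc)
  have "R = c powr (b - 1) * (c powr (1 - b) * R)"
    by (rule cc[symmetric])
  also note main
  also have "c powr (b - 1) * ((1 - t) * ((\<epsilon> / t) powr (1 - k) * y powr k))
      = c powr (b - 1) * (c powr (1 - b) * ((1 - t) * (1 - t) powr (b - 1) * (\<epsilon> / t) powr (1 - k) * Q powr k))"
    unfolding yk by (simp only: mult_ac)
  also have "\<dots> = (1 - t) powr b * (\<epsilon> / t) powr (1 - k) * Q powr k"
    unfolding cc using \<open>t < 1\<close> by (simp add: powr_diff)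
  finally show ?thesis
    unfolding R_def Q_def r_def .
qed

text \<open>Serves \<open>\<beta> = \<infinity>\<close>: the truncated vector stays below
  \<open>c * q\<close>, so its divergence of infinite order is at most \<open>log 2 c\<close>, and
  the conclusion is an upper bound on \<open>c\<close>.\<close>

lemma truncation_level_bound:
  fixes p q :: "'i \<Rightarrow> real"
  assumes "finite S" and p: "\<And>x. x \<in> S \<Longrightarrow> 0 \<le> p x" and q: "\<And>x. x \<in> S \<Longrightarrow> 0 < p x \<Longrightarrow> 0 < q x"
    and q0: "\<And>x. x \<in> S \<Longrightarrow> 0 \<le> q x"
    and sp: "sum p S = 1" and "0 < c" and sr: "(\<Sum>x\<in>S. min (p x) (c * q x)) = 1 - \<epsilon>"
    and "1 < a" "0 < \<epsilon>" "\<epsilon> \<le> t" "t < 1"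
    and t: "1 - t \<le> t * (a - 1)" and e: "(1 - t) / (a - 1) * (1 - \<epsilon> / t) = t - \<epsilon>"
  shows "\<epsilon> / t \<le> ((1 - t) / c) powr (a - 1) * (\<Sum>x\<in>S. p x powr a * q x powr (1 - a))"
proof -
  define r where "r x = min (p x) (c * q x)" for x
  define Q where "Q = (\<Sum>x\<in>S. p x powr a * q x powr (1 - a))"
  define w where "w = ((1 - t) / c) powr (a - 1)"
  have t0: "0 < t" using assms by simp
  have pointwise: "p x - r x - t * p x \<le> (1 - t) / (a - 1) * (w * (p x powr a * q x powr (1 - a)) - p x)"
    if x: "x \<in> S" for x
  proof (cases "p x = 0")
    case True
    then show ?thesis using q0[OF x] \<open>0 < c\<close> by (simp add: r_def)
  next
    case False
    then have px: "0 < p x" "0 < q x" using p[OF x] q[OF x] by auto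
    define u where "u = p x / (c * q x)"
    have u: "0 < u" "q x = p x / (c * u)" using px \<open>0 < c\<close> by (auto simp: u_def)
    have r: "r x = p x * min 1 (1 / u)"
      using px \<open>0 < c\<close> u(1) by (auto simp: r_def u_def min_def field_simps)
    have 2: "w * (p x powr a * q x powr (1 - a)) = p x * ((1 - t) * u) powr (a - 1)"
      using px u \<open>0 < c\<close> \<open>t < 1\<close> by (simp add: w_def powr_mult powr_divide powr_diff)
    have "p x * (1 - min 1 (1 / u) - t) \<le> p x * ((1 - t) / (a - 1) * (((1 - t) * u) powr (a - 1) - 1))"
      using assms u px t0 by (intro mult_left_mono truncation_pointwise_infinity) auto
    then show ?thesis
      unfolding 2 using r by (simp add: algebra_simps)
  qed
  have "\<epsilon> - t = (\<Sum>x\<in>S. p x - r x - t * p x)"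
    using sp sr by (simp add: r_def sum_subtractf flip: sum_distrib_left)
  also have "\<dots> \<le> (\<Sum>x\<in>S. (1 - t) / (a - 1) * (w * (p x powr a * q x powr (1 - a)) - p x))"
    by (intro sum_mono pointwise)
  also have "\<dots> = (1 - t) / (a - 1) * (w * Q - 1)"
    using sp by (simp add: Q_def sum_subtractf flip: sum_distrib_left del: times_divide_eq_left)
  finally have "(1 - t) / (a - 1) * (\<epsilon> / t) \<le> (1 - t) / (a - 1) * (w * Q)"
    using e by (simp add: right_diff_distrib del: times_divide_eq_left times_divide_eq_right)
  moreover have "0 < (1 - t) / (a - 1)"
    using \<open>t < 1\<close> \<open>1 < a\<close> by simp
  ultimately show ?thesis
    unfolding w_def Q_def by (rule mult_left_le_imp_le)
qed

text \<open>Intermediate value theorem between \<open>c = 0\<close>, where everything is cut, and a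
  level above all likelihood ratios, where nothing is.\<close>

lemma truncation_level_exists:
  fixes p q :: "'i \<Rightarrow> real"
  assumes "finite S" and p: "\<And>x. x \<in> S \<Longrightarrow> 0 \<le> p x" and q: "\<And>x. x \<in> S \<Longrightarrow> 0 < p x \<Longrightarrow> 0 < q x"
    and q0: "\<And>x. x \<in> S \<Longrightarrow> 0 \<le> q x"
    and sp: "sum p S = 1" and "0 < \<epsilon>" "\<epsilon> < 1"
  obtains c where "0 < c" "(\<Sum>x\<in>S. min (p x) (c * q x)) = 1 - \<epsilon>"
proof -
  define F where "F c = (\<Sum>x\<in>S. min (p x) (c * q x))" for c
  \<comment> \<open>The sum dominates every single ratio; where \<open>q x = 0\<close> also
    \<open>p x = 0\<close>, and \<open>0 / 0 = 0\<close>.\<close>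
  define C where "C = (\<Sum>x\<in>S. p x / q x)"
  have "p x \<le> C * q x" if x: "x \<in> S" for x
  proof (cases "p x = 0")
    case True
    then show ?thesis using q0 p x by (auto simp: C_def intro!: mult_nonneg_nonneg sum_nonneg)
  next
    case False
    then have px: "0 < p x" "0 < q x" using p[OF x] q[OF x] by auto
    have "p x / q x \<le> C" unfolding C_def
      using assms x by (intro member_le_sum) auto
    then show ?thesis using px by (simp add: field_simps)
  qed
  then have FC: "F C = 1" unfolding F_def using sp by (simp add: min_absorb1 cong: sum.cong)
  have F0: "F 0 = 0" unfolding F_def using p by (auto intro!: sum.neutral simp: min_def intro: antisym)
  have "0 \<le> C" unfolding C_def using p q0 by (auto intro!: sum_nonneg)
  then have "\<exists>c. 0 \<le> c \<and> c \<le> C \<and> F c = 1 - \<epsilon>"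
    using F0 FC assms by (intro IVT') (auto simp: F_def intro!: continuous_intros)
  then obtain c where c: "0 \<le> c" "F c = 1 - \<epsilon>" by auto
  then have "c \<noteq> 0" using F0 assms by auto
  then show ?thesis using c by (intro that[of c]) (auto simp: F_def)
qed

section \<open>Filling from below\<close>

text \<open>Both values lie below the tangent at the mean \<open>m\<close>, and averaging the two
  tangent values gives back \<open>m powr k\<close>.\<close>

lemma powr_concave:
  fixes k v \<mu> x y :: real
  assumes "0 \<le> k" "k \<le> 1" "0 < v" "0 < \<mu>" "v + \<mu> = 1" "0 \<le> x" "0 \<le> y"
  shows "v * x powr k + \<mu> * y powr k \<le> (v * x + \<mu> * y) powr k"
proof (cases "v * x + \<mu> * y = 0")
  case True
  then have "v * x = 0" "\<mu> * y = 0"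
    using assms by (simp_all add: add_nonneg_eq_0_iff)
  then show ?thesis using assms by simp
next
  case False
  define m where "m = v * x + \<mu> * y"
  have m: "0 < m" using False assms by (simp add: m_def less_le)
  have tangent: "z powr k \<le> m powr k * (1 + k * (z / m - 1))" if "0 \<le> z" for z
  proof -
    have "m powr k * (z / m) powr k \<le> m powr k * (1 + k * (z / m - 1))"
      using that m assms by (intro mult_left_mono powr_le_tangent) auto
    then show ?thesis using m that by (simp add: powr_divide)
  qed
  have "v * x powr k + \<mu> * y powr k
      \<le> v * (m powr k * (1 + k * (x / m - 1))) + \<mu> * (m powr k * (1 + k * (y / m - 1)))"
    using assms by (intro add_mono mult_left_mono tangent) auto
  also have "\<dots> = m powr k * ((v + \<mu>) * (1 - k) + k * ((v * x + \<mu> * y) / m))"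
    by (simp add: algebra_simps add_divide_distrib)
  also have "\<dots> = m powr k"
    using assms m unfolding m_def[symmetric] by simp
  finally show ?thesis unfolding m_def .
qed

text \<open>A form of the reverse Minkowski inequality. By homogeneity \<open>A\<close> and
  \<open>B\<close> can be rescaled by \<open>Q / QA\<close> and \<open>Q / QB\<close>; then
  \<open>A + B\<close> is their convex combination with weights \<open>QA / Q\<close> and
  \<open>QB / Q\<close>, and concavity applies pointwise. If \<open>QA\<close> or \<open>QB\<close>
  is 0, monotonicity suffices.\<close>

lemma sum_powr_superadditive:
  fixes w A B :: "'i \<Rightarrow> real"
  assumes "\<And>x. x \<in> S \<Longrightarrow> 0 \<le> w x"
    and A: "\<And>x. x \<in> S \<Longrightarrow> 0 \<le> A x" and B: "\<And>x. x \<in> S \<Longrightarrow> 0 \<le> B x"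
    and k: "0 \<le> k" "k \<le> 1" and Q: "0 \<le> QA" "0 \<le> QB"
    and RA: "V * QA powr k \<le> (\<Sum>x\<in>S. w x * A x powr k)"
    and RB: "V * QB powr k \<le> (\<Sum>x\<in>S. w x * B x powr k)"
  shows "V * (QA + QB) powr k \<le> (\<Sum>x\<in>S. w x * (A x + B x) powr k)"
proof -
  consider "QA = 0" | "QB = 0" | "0 < QA" "0 < QB"
    using Q by linarith
  then show ?thesis
  proof cases
    case 1
    note RB
    also have "(\<Sum>x\<in>S. w x * B x powr k) \<le> (\<Sum>x\<in>S. w x * (A x + B x) powr k)"
      using assms by (intro sum_mono mult_left_mono powr_mono2) auto
    finally show ?thesis using 1 by simp
  next
    case 2
    note RA
    also have "(\<Sum>x\<in>S. w x * A x powr k) \<le> (\<Sum>x\<in>S. w x * (A x + B x) powr k)"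
      using assms by (intro sum_mono mult_left_mono powr_mono2) auto
    finally show ?thesis using 2 by simp
  next
    case 3
    define Q where "Q = QA + QB"
    have Q: "0 < Q" using 3 by (simp add: Q_def)
    have pointwise: "Q powr k * (QA / Q * (A x powr k / QA powr k) + QB / Q * (B x powr k / QB powr k))
        \<le> (A x + B x) powr k" if x: "x \<in> S" for x
    proof -
      have "QA / Q * (Q / QA * A x) powr k + QB / Q * (Q / QB * B x) powr k
          \<le> (QA / Q * (Q / QA * A x) + QB / Q * (Q / QB * B x)) powr k"
        using 3 Q A[OF x] B[OF x] k
        by (intro powr_concave) (auto simp: Q_def simp flip: add_divide_distrib)
      moreover have "QA / Q * (Q / QA * A x) + QB / Q * (Q / QB * B x) = A x + B x"
        using 3 Q by simp
      ultimately show ?thesis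
        using 3 Q by (simp add: powr_mult powr_divide algebra_simps)
    qed
    have "QA / Q + QB / Q = 1"
      using Q by (simp add: Q_def flip: add_divide_distrib)
    then have "QA / Q * V + QB / Q * V = V"
      by (simp only: distrib_right[symmetric] mult_1)
    then have "V * Q powr k = Q powr k * (QA / Q * V + QB / Q * V)"
      by simp
    also have "\<dots> \<le> Q powr k * (QA / Q * ((\<Sum>x\<in>S. w x * A x powr k) / QA powr k)
        + QB / Q * ((\<Sum>x\<in>S. w x * B x powr k) / QB powr k))"
      using 3 Q RA RB by (intro mult_left_mono add_mono) (auto simp: field_simps)
    also have "\<dots> = (\<Sum>x\<in>S. w x * (Q powr k * (QA / Q * (A x powr k / QA powr k) + QB / Q * (B x powr k / QB powr k))))"
      unfolding sum_distrib_left sum_divide_distrib sum.distrib[symmetric]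
      by (intro sum.cong refl) (simp add: algebra_simps)
    also have "\<dots> \<le> (\<Sum>x\<in>S. w x * (A x + B x) powr k)"
      using assms by (intro sum_mono mult_left_mono pointwise) auto
    finally show ?thesis unfolding Q_def .
  qed
qed

text \<open>The pointwise bound is summed, and weighted AM-GM with weights
  \<open>b * \<theta>\<close> and \<open>k\<close>, which add up to 1, turns it into a product free
  of \<open>c\<close>. Neither vector is assumed normalised, so an artificial reference vector can
  later take the place of \<open>q\<close>.\<close>

lemma filled_sum_ge:
  fixes p q :: "'i \<Rightarrow> real"
  assumes "finite S" and p: "\<And>x. x \<in> S \<Longrightarrow> 0 \<le> p x" and q: "\<And>x. x \<in> S \<Longrightarrow> 0 \<le> q x"
    and "0 < c" and \<epsilon>: "(\<Sum>x\<in>S. max 0 (c * q x - p x)) = \<epsilon>" "0 < \<epsilon>"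
    and ab: "0 < a" "a < b" "b < 1"
    and k: "k = (1 - b) / (1 - a)" and \<theta>: "\<theta> = (b - a) / (b * (1 - a))"
  shows "(\<epsilon> / \<theta>) powr (b * \<theta>) * (1 - \<theta>) powr (- (a * k)) * (\<Sum>x\<in>S. p x powr a * q x powr (1 - a)) powr k
    \<le> (\<Sum>x\<in>S. max (p x) (c * q x) powr b * q x powr (1 - b))"
proof -
  define Q where "Q = (\<Sum>x\<in>S. p x powr a * q x powr (1 - a))"
  have bt: "b * \<theta> = (b - a) / (1 - a)" using ab by (simp add: \<theta>)
  have sum1: "b * \<theta> + k = 1" using ab unfolding bt k by (simp add: field_simps)
  have \<theta>0: "0 < \<theta>" using ab by (simp add: \<theta>)
  have "1 - \<theta> = a * (1 - b) / (b * (1 - a))"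
    using ab by (simp add: \<theta> field_simps)
  then have \<theta>1: "0 < 1 - \<theta>" using ab by simp
  have k0: "0 < k" using ab by (simp add: k)
  have pointwise: "b * c powr (b - 1) * max 0 (c * q x - p x)
      + k * (c powr (b - a) * (1 - \<theta>) powr (- a) * (p x powr a * q x powr (1 - a)))
      \<le> max (p x) (c * q x) powr b * q x powr (1 - b)" if x: "x \<in> S" for x
  proof (cases "q x = 0")
    case True
    then show ?thesis using p[OF x] by simp
  next
    case False
    then have qx: "0 < q x" using q[OF x] by simp
    define u where "u = p x / (c * q x)"
    have u: "0 \<le> u" "p x = u * (c * q x)" using qx p[OF x] \<open>0 < c\<close> by (auto simp: u_def)
    have cq: "0 < c * q x" using qx \<open>0 < c\<close> by simp
    have 1: "max (p x) (c * q x) = c * q x * max u 1"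
      using cq max_mult_distrib_left[of "c * q x" u 1] by (simp add: u(2) mult.commute)
    have 2: "max 0 (c * q x - p x) = c * q x * max 0 (1 - u)"
      using cq max_mult_distrib_left[of "c * q x" 0 "1 - u"] by (simp add: u(2) algebra_simps)
    have "c powr b * q x * (b * max 0 (1 - u) + k * (u / (1 - \<theta>)) powr a)
        \<le> c powr b * q x * max u 1 powr b"
      using qx u ab k \<theta> by (intro mult_left_mono filling_pointwise) auto
    also have "\<dots> = max (p x) (c * q x) powr b * q x powr (1 - b)"
      unfolding 1 using qx \<open>0 < c\<close> by (simp add: powr_mult powr_diff)
    finally show ?thesis
      unfolding 2 unfolding u(2) using qx \<open>0 < c\<close> \<theta>1
      by (simp add: powr_mult powr_divide powr_diff powr_minus field_simps)
  qed
  \<comment> \<open>Dividing by \<open>\<theta>\<close> gives the mass term the weight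
    \<open>b * \<theta>\<close>, so that \<open>b * \<theta> * X + k * Y\<close> is exactly the
    summed pointwise bound.\<close>
  define X where "X = c powr (b - 1) * (\<epsilon> / \<theta>)"
  define Y where "Y = c powr (b - a) * (1 - \<theta>) powr (- a) * Q"
  have "X powr (b * \<theta>) * Y powr k \<le> b * \<theta> * X + k * Y"
  proof (cases "Q = 0")
    case True
    then show ?thesis using ab \<theta>0 \<epsilon> \<open>0 < c\<close> by (simp add: X_def Y_def)
  next
    case False
    moreover have "0 \<le> Q" by (auto simp: Q_def intro!: sum_nonneg)
    ultimately show ?thesis
      using ab \<theta>0 \<theta>1 \<epsilon> \<open>0 < c\<close> k0 sum1 by (intro Youngs_inequality_0) (auto simp: X_def Y_def)
  qed
  also have "\<dots> = b * c powr (b - 1) * \<epsilon> + k * Y"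
    using \<theta>0 by (simp add: X_def)
  also have "\<dots> = (\<Sum>x\<in>S. b * c powr (b - 1) * max 0 (c * q x - p x)
      + k * (c powr (b - a) * (1 - \<theta>) powr (- a) * (p x powr a * q x powr (1 - a))))"
    by (simp add: Y_def Q_def sum.distrib flip: \<epsilon>(1) sum_distrib_left)
  also have "\<dots> \<le> (\<Sum>x\<in>S. max (p x) (c * q x) powr b * q x powr (1 - b))"
    by (intro sum_mono pointwise)
  also have "X powr (b * \<theta>) * Y powr k
      = c powr ((b - 1) * (b * \<theta>) + (b - a) * k) * ((\<epsilon> / \<theta>) powr (b * \<theta>) * (1 - \<theta>) powr (- (a * k)) * Q powr k)"
    unfolding X_def Y_def powr_mult powr_powr powr_add by (simp only: mult_ac minus_mult_left)
  also have "(b - 1) * (b * \<theta>) + (b - a) * k = 0"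
    unfolding bt k by (simp add: algebra_simps flip: add_divide_distrib diff_divide_distrib)
  finally show ?thesis using \<open>0 < c\<close> by (simp add: Q_def)
qed

lemma renyi_sum_le_1:
  fixes p q :: "'i \<Rightarrow> real"
  assumes p: "\<And>x. x \<in> S \<Longrightarrow> 0 \<le> p x" and q: "\<And>x. x \<in> S \<Longrightarrow> 0 \<le> q x"
    and "sum p S \<le> 1" "sum q S \<le> 1" "0 < a" "a < 1"
  shows "(\<Sum>x\<in>S. p x powr a * q x powr (1 - a)) \<le> 1"
proof -
  have "(\<Sum>x\<in>S. p x powr a * q x powr (1 - a)) \<le> (\<Sum>x\<in>S. a * p x + (1 - a) * q x)"
  proof (intro sum_mono)
    fix x assume x: "x \<in> S"
    show "p x powr a * q x powr (1 - a) \<le> a * p x + (1 - a) * q x"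
    proof (cases "p x = 0 \<or> q x = 0")
      case True
      then show ?thesis using p[OF x] q[OF x] assms by auto
    next
      case False
      then show ?thesis using p[OF x] q[OF x] assms by (intro Youngs_inequality_0) auto
    qed
  qed
  also have "\<dots> = a * sum p S + (1 - a) * sum q S"
    by (simp add: sum.distrib flip: sum_distrib_left)
  also have "\<dots> \<le> a * 1 + (1 - a) * 1"
    using assms by (intro add_mono mult_left_mono) auto
  finally show ?thesis by simp
qed

text \<open>Mass \<open>\<epsilon>\<close> is added below the level \<open>c\<close>, and mass
  \<open>\<epsilon>\<close> is removed by \<open>d\<close> where \<open>p / q\<close> is largest.
  The cap on the ratio is recorded by its reciprocal \<open>\<kappa>\<close>, so that an infinite
  cap, needed when \<open>p\<close> has mass at least \<open>\<epsilon>\<close> outside the support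
  of \<open>q\<close>, is \<open>\<kappa> = 0\<close>. Assumption \<open>far\<close> keeps the
  levels apart: filling happens below ratio 1 and cutting above it.\<close>

lemma filling_exists:
  fixes p q :: "'i \<Rightarrow> real"
  assumes "finite S" and p: "\<And>x. x \<in> S \<Longrightarrow> 0 \<le> p x" and q: "\<And>x. x \<in> S \<Longrightarrow> 0 \<le> q x"
    and sp: "sum p S = 1" and sq: "sum q S = 1"
    and "0 < \<epsilon>" and far: "\<epsilon> < (\<Sum>x\<in>S. max 0 (q x - p x))"
  obtains c \<kappa> d where "0 < c" "c < 1" "(\<Sum>x\<in>S. max 0 (c * q x - p x)) = \<epsilon>"
    "0 \<le> \<kappa>" "\<kappa> \<le> 1" "sum d S = \<epsilon>" "\<And>x. x \<in> S \<Longrightarrow> 0 \<le> d x" "\<And>x. x \<in> S \<Longrightarrow> d x \<le> p x"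
    "\<And>x. x \<in> S \<Longrightarrow> \<kappa> * (p x - d x) \<le> q x"
    "\<And>x. x \<in> S \<Longrightarrow> 0 < d x \<Longrightarrow> q x = \<kappa> * (p x - d x)"
proof -
  define F where "F c = (\<Sum>x\<in>S. max 0 (c * q x - p x))" for c
  have F0: "F 0 = 0" unfolding F_def using p by (auto intro!: sum.neutral simp: max_def intro: antisym)
  have "\<exists>c. 0 \<le> c \<and> c \<le> 1 \<and> F c = \<epsilon>"
    using F0 far \<open>0 < \<epsilon>\<close> by (intro IVT') (auto simp: F_def intro!: continuous_intros)
  then obtain c where "0 \<le> c" "c \<le> 1" "F c = \<epsilon>" by auto
  moreover from this have "c \<noteq> 0" "c \<noteq> 1"
    using F0 far \<open>0 < \<epsilon>\<close> by (auto simp: F_def)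
  ultimately have c: "0 < c" "c < 1" "F c = \<epsilon>" by auto
  define P where "P = (\<Sum>x\<in>S. if q x = 0 then p x else 0)"
  show ?thesis
  proof (cases "\<epsilon> \<le> P")
    case True
    define d where "d x = (if q x = 0 then \<epsilon> / P * p x else 0)" for x
    have "sum d S = \<epsilon> / P * P"
      unfolding P_def sum_distrib_left d_def by (intro sum.cong) auto
    then have sd: "sum d S = \<epsilon>" using True \<open>0 < \<epsilon>\<close> by simp
    have P: "0 \<le> \<epsilon> / P" "\<epsilon> / P \<le> 1" using True \<open>0 < \<epsilon>\<close> by auto
    show ?thesis
    proof (rule that[of c 0 d])
      show "0 \<le> d x" if "x \<in> S" for x
        using mult_nonneg_nonneg[OF P(1) p[OF that]] by (auto simp: d_def)
      show "d x \<le> p x" if "x \<in> S" for x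
        using P p[OF that] mult_right_mono[of "\<epsilon> / P" 1 "p x"] by (auto simp: d_def)
    qed (use c sd P p q in \<open>auto simp: F_def d_def split: if_splits\<close>)
  next
    case False
    define G where "G C = (\<Sum>x\<in>S. max 0 (p x - C * q x))" for C
    \<comment> \<open>Since \<open>p\<close> and \<open>q\<close> have equal mass, the excess of
      \<open>p\<close> over \<open>q\<close> equals that of \<open>q\<close> over \<open>p\<close>;
      so the cap 1 removes more than \<open>\<epsilon>\<close>.\<close>
    have "G 1 = (\<Sum>x\<in>S. max 0 (q x - p x) + (p x - q x))"
      unfolding G_def by (intro sum.cong) auto
    then have G1: "\<epsilon> < G 1" using far sp sq by (simp add: sum.distrib sum_subtractf)
    \<comment> \<open>At this cap only the mass \<open>P\<close> outside the support of
      \<open>q\<close> is still removed.\<close>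
    define C1 where "C1 = 1 + (\<Sum>x\<in>S. p x / q x)"
    have "0 \<le> (\<Sum>x\<in>S. p x / q x)" using p q by (intro sum_nonneg) auto
    then have C1: "1 \<le> C1" by (simp add: C1_def)
    have "max 0 (p x - C1 * q x) = (if q x = 0 then p x else 0)" if x: "x \<in> S" for x
    proof (cases "q x = 0")
      case False
      then have qx: "0 < q x" using q[OF x] by simp
      have "p x / q x \<le> (\<Sum>x\<in>S. p x / q x)"
        using assms x by (intro member_le_sum) auto
      then have "p x / q x \<le> C1" by (simp add: C1_def)
      then show ?thesis using qx by (simp add: field_simps)
    qed (use p[OF x] in auto)
    then have "G C1 = P" unfolding G_def P_def by (intro sum.cong) auto
    then have "\<exists>C. 1 \<le> C \<and> C \<le> C1 \<and> G C = \<epsilon>"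
      using G1 C1 False by (intro IVT2') (auto simp: G_def intro!: continuous_intros)
    then obtain C where C: "1 \<le> C" "G C = \<epsilon>" by auto
    show ?thesis
    proof (rule that[of c "1 / C" "\<lambda>x. max 0 (p x - C * q x)"])
      fix x assume x: "x \<in> S"
      show "1 / C * (p x - max 0 (p x - C * q x)) \<le> q x"
        using C by (auto simp: max_def field_simps)
      show "q x = 1 / C * (p x - max 0 (p x - C * q x))" if "0 < max 0 (p x - C * q x)"
        using that C by (auto simp: max_def field_simps split: if_splits)
    qed (use c C p q in \<open>auto simp: F_def G_def\<close>)
  qed
qed

text \<open>
  With \<open>t = q powr (1 - a)\<close>, both sums are homogeneous in \<open>t\<close>: one is linear and the other concave to
  the power \<open>k\<close>.  So \<open>t\<close> may be split into a part proportional to \<open>r powr (1 - a)\<close>, on which the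
  bound holds with constant \<open>1\<close>, and a remainder on which nothing has been removed from \<open>p\<close>.
\<close>
lemma filled_renyi_sum_ge:
  fixes p q :: "'i \<Rightarrow> real"
  assumes "finite S" and p: "\<And>x. x \<in> S \<Longrightarrow> 0 \<le> p x" and q: "\<And>x. x \<in> S \<Longrightarrow> 0 \<le> q x"
    and sp: "sum p S = 1" and sq: "sum q S = 1"
    and "0 < \<epsilon>" and ab: "0 < a" "a < b" "b < 1"
    and k: "k = (1 - b) / (1 - a)" and \<theta>: "\<theta> = (b - a) / (b * (1 - a))"
    and V: "V \<le> 1" "V \<le> (\<epsilon> / \<theta>) powr (b * \<theta>) * (1 - \<theta>) powr (- (a * k))"
  obtains r where "\<And>x. x \<in> S \<Longrightarrow> 0 \<le> r x" "sum r S = 1" "(\<Sum>x\<in>S. max (p x - r x) 0) \<le> \<epsilon>"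
    "V * (\<Sum>x\<in>S. p x powr a * q x powr (1 - a)) powr k \<le> (\<Sum>x\<in>S. r x powr b * q x powr (1 - b))"
proof (cases "(\<Sum>x\<in>S. max 0 (q x - p x)) \<le> \<epsilon>")
  \<comment> \<open>Here \<open>q\<close> itself is within reach of \<open>p\<close>, and
    \<open>r = q\<close> gives the right-hand side 1.\<close>
  case True
  have k0: "0 \<le> k" using ab by (simp add: k)
  let ?Q = "\<Sum>x\<in>S. p x powr a * q x powr (1 - a)"
  have "0 \<le> ?Q" by (intro sum_nonneg) auto
  moreover have "?Q \<le> 1"
    using assms by (intro renyi_sum_le_1) auto
  ultimately have "?Q powr k \<le> 1"
    using k0 by (simp add: powr_le1)
  then have "V * ?Q powr k \<le> 1"
    using V(1) mult_mono[of V 1 "?Q powr k" 1] by simp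
  also have "1 = (\<Sum>x\<in>S. q x powr b * q x powr (1 - b))"
    using sq q by (simp flip: powr_add)
  finally show ?thesis
  proof (rule that[rotated -1])
    have "(\<Sum>x\<in>S. max (p x - q x) 0) = (\<Sum>x\<in>S. max 0 (q x - p x) + (p x - q x))"
      by (intro sum.cong) auto
    then show "(\<Sum>x\<in>S. max (p x - q x) 0) \<le> \<epsilon>"
      using True sp sq by (simp add: sum.distrib sum_subtractf)
  qed (use q sq in auto)
next
  case False
  then obtain c \<kappa> d where c: "0 < c" "c < 1" and fill: "(\<Sum>x\<in>S. max 0 (c * q x - p x)) = \<epsilon>"
    and \<kappa>: "0 \<le> \<kappa>" "\<kappa> \<le> 1" and d: "sum d S = \<epsilon>" "\<And>x. x \<in> S \<Longrightarrow> 0 \<le> d x"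
      "\<And>x. x \<in> S \<Longrightarrow> d x \<le> p x" "\<And>x. x \<in> S \<Longrightarrow> \<kappa> * (p x - d x) \<le> q x"
      "\<And>x. x \<in> S \<Longrightarrow> 0 < d x \<Longrightarrow> q x = \<kappa> * (p x - d x)"
    by (auto intro: filling_exists[OF assms(1) p q sp sq \<open>0 < \<epsilon>\<close>])
  have k0: "0 < k" "k \<le> 1" using ab by (simp_all add: k)
  have kk: "(1 - a) * k = 1 - b" and kk': "k * (1 - a) = 1 - b" using ab by (simp_all add: k)
  define r where "r x = max (p x) (c * q x) - d x" for x
  have r0: "0 \<le> r x" if "x \<in> S" for x using d(3)[OF that] by (auto simp: r_def)
  have "sum r S = (\<Sum>x\<in>S. p x + max 0 (c * q x - p x) - d x)"
    unfolding r_def by (intro sum.cong) auto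
  then have sr: "sum r S = 1" using sp fill d(1) by (simp add: sum.distrib sum_subtractf)
  have \<kappa>c: "\<kappa> * c < 1"
    using c \<kappa> mult_left_le_one_le[of c \<kappa>] by linarith
  have \<kappa>p: "\<kappa> * y \<le> y" if "0 \<le> y" for y
    using that \<kappa> by (simp add: mult_left_le_one_le)
  \<comment> \<open>Where mass is removed, the ratio is above the filling level, so removal and
    filling never meet.\<close>
  have removed: "c * q x \<le> p x" if "x \<in> S" "0 < d x" for x
  proof -
    have "c * q x \<le> 1 * q x" using c q[OF that(1)] by (intro mult_right_mono) auto
    also have "\<dots> = \<kappa> * (p x - d x)" using d(5)[OF that] by simp
    also have "\<dots> \<le> p x - d x" using \<kappa>p d(3)[OF that(1)] by simp
    finally show ?thesis using that by simp
  qed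
  have loss: "(\<Sum>x\<in>S. max (p x - r x) 0) \<le> \<epsilon>"
  proof -
    have "(\<Sum>x\<in>S. max (p x - r x) 0) \<le> sum d S"
      using d(2) by (intro sum_mono) (auto simp: r_def)
    then show ?thesis using d(1) by simp
  qed
  have \<kappa>r: "\<kappa> * r x \<le> q x" if x: "x \<in> S" for x
  proof (cases "d x = 0 \<and> p x \<le> c * q x")
    case True
    have "\<kappa> * c * q x \<le> 1 * q x" using \<kappa>c q[OF x] by (intro mult_right_mono) auto
    then show ?thesis using True by (simp add: r_def max_def mult.assoc)
  next
    case False
    then have "r x = p x - d x" using removed[OF x] d(2)[OF x] by (auto simp: r_def)
    then show ?thesis using d(4)[OF x] by simp
  qed
  \<comment> \<open>Since \<open>\<kappa> * r x \<le> q x\<close>, the remainder \<open>tB\<close>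
    is nonnegative; since equality holds wherever \<open>d x > 0\<close>, it vanishes there.\<close>
  define tA where "tA x = (\<kappa> * r x) powr (1 - a)" for x
  define tB where "tB x = q x powr (1 - a) - tA x" for x
  \<comment> \<open>\<open>qB\<close> is the reference vector whose power \<open>1 - a\<close> is
    the remainder. On the filled region \<open>tB x = (c * q x) powr (1 - a) * l\<close>, and
    \<open>c'\<close> is the level for which \<open>c' * qB x = c * q x\<close> there.\<close>
  define qB where "qB x = tB x powr (1 / (1 - a))" for x
  define l where "l = (1 / c) powr (1 - a) - \<kappa> powr (1 - a)"
  define c' where "c' = l powr (- (1 / (1 - a)))"
  have l: "0 < l"
    unfolding l_def using powr_less_mono2[of "1 - a" \<kappa> "1 / c"] \<kappa>c \<kappa> c ab by (simp add: field_simps)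
  then have c': "0 < c'" by (simp add: c'_def)
  have tB0: "0 \<le> tB x" if "x \<in> S" for x
    unfolding tB_def tA_def using \<kappa>r[OF that] \<kappa> r0[OF that] ab by (auto intro!: powr_mono2)
  have qB: "qB x powr (1 - a) = tB x" if "x \<in> S" for x
    unfolding qB_def using ab tB0[OF that] by (simp add: powr_powr)
  have c'l: "c' * (y powr (1 - a) * l) powr (1 / (1 - a)) = y" if "0 \<le> y" for y
  proof -
    have "l powr (- (1 / (1 - a))) * l powr (1 / (1 - a)) = 1"
      using l by (simp flip: powr_add)
    then show ?thesis
      using that ab l by (simp add: c'_def powr_mult powr_powr)
  qed
  \<comment> \<open>Filling \<open>p\<close> against \<open>qB\<close> at level \<open>c'\<close>
    adds the same mass at every point as against \<open>q\<close> at level \<open>c\<close>; where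
    \<open>qB\<close> is positive nothing was removed, so the filled vector is \<open>r\<close>
    itself and \<open>filled_sum_ge\<close> applies to it.\<close>
  have remainder: "max 0 (c' * qB x - p x) = max 0 (c * q x - p x)
      \<and> (0 < qB x \<longrightarrow> max (p x) (c' * qB x) = r x)" if x: "x \<in> S" for x
  proof (cases "qB x = 0")
    case True
    have "c * q x \<le> p x"
    proof (rule ccontr)
      assume "\<not> c * q x \<le> p x"
      then have gt: "p x < c * q x" by simp
      then have "d x = 0" using removed[OF x] d(2)[OF x] by fastforce
      then have "r x = c * q x" using gt by (simp add: r_def)
      moreover have "0 < q x" using gt p[OF x] c by (smt (verit) zero_less_mult_iff)
      ultimately have "\<kappa> * r x < q x" using \<kappa>c mult_strict_right_mono[of "\<kappa> * c" 1 "q x"] by (simp add: mult.assoc)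
      then have "tA x < q x powr (1 - a)"
        unfolding tA_def using \<kappa> r0[OF x] ab by (intro powr_less_mono2) auto
      then show False using True by (simp add: qB_def tB_def)
    qed
    then show ?thesis using True p[OF x] by simp
  next
    case False
    have "d x = 0"
    proof (rule ccontr)
      assume "d x \<noteq> 0"
      then have "0 < d x" using d(2)[OF x] by simp
      then have "q x = \<kappa> * r x" using d(5)[OF x] removed[OF x] by (simp add: r_def)
      then show False using False by (simp add: qB_def tB_def tA_def)
    qed
    then have r: "r x = max (p x) (c * q x)" by (simp add: r_def)
    show ?thesis
    proof (cases "p x \<le> c * q x")
      case True
      have "tB x = (c * q x) powr (1 - a) * l"
        using True r c by (simp add: tB_def tA_def l_def powr_mult powr_divide field_simps)
      then have "c' * qB x = c * q x"
        using c'l[of "c * q x"] c q[OF x] by (simp add: qB_def)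
      then show ?thesis using r by simp
    next
      case False
      have "q x powr (1 - a) \<le> (p x / c) powr (1 - a)"
        using False q[OF x] c ab by (intro powr_mono2) (auto simp: field_simps)
      then have "tB x \<le> p x powr (1 - a) * l"
        using False r c by (simp add: tB_def tA_def l_def powr_mult powr_divide algebra_simps)
      then have "c' * qB x \<le> c' * (p x powr (1 - a) * l) powr (1 / (1 - a))"
        unfolding qB_def using c' ab tB0[OF x] by (intro mult_left_mono powr_mono2) auto
      then show ?thesis using c'l[of "p x"] p[OF x] r False by simp
    qed
  qed
  have "V * (\<Sum>x\<in>S. p x powr a * tB x) powr k \<le> (\<Sum>x\<in>S. r x powr b * tB x powr k)"
  proof -
    have "V * (\<Sum>x\<in>S. p x powr a * tB x) powr k
        \<le> (\<epsilon> / \<theta>) powr (b * \<theta>) * (1 - \<theta>) powr (- (a * k)) * (\<Sum>x\<in>S. p x powr a * tB x) powr k"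
      using V by (intro mult_right_mono) auto
    also have "(\<Sum>x\<in>S. p x powr a * tB x) = (\<Sum>x\<in>S. p x powr a * qB x powr (1 - a))"
      using qB by simp
    also have "(\<epsilon> / \<theta>) powr (b * \<theta>) * (1 - \<theta>) powr (- (a * k)) * (\<Sum>x\<in>S. p x powr a * qB x powr (1 - a)) powr k
        \<le> (\<Sum>x\<in>S. max (p x) (c' * qB x) powr b * qB x powr (1 - b))"
      using remainder fill assms c' by (intro filled_sum_ge) (auto simp: qB_def)
    also have "\<dots> = (\<Sum>x\<in>S. r x powr b * tB x powr k)"
    proof (intro sum.cong refl)
      fix x assume x: "x \<in> S"
      show "max (p x) (c' * qB x) powr b * qB x powr (1 - b) = r x powr b * tB x powr k"
      proof (cases "qB x = 0")
        case True
        then show ?thesis using qB[OF x] by simp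
      next
        case False
        then have "max (p x) (c' * qB x) = r x"
          using remainder[OF x] by (simp add: qB_def)
        then show ?thesis unfolding qB[OF x, symmetric] by (simp add: powr_powr kk)
      qed
    qed
    finally show ?thesis using qB by simp
  qed
  \<comment> \<open>Up to matching powers of \<open>\<kappa>\<close>, the left side contains the
    \<open>\<alpha>\<close>-sum of \<open>p\<close> against \<open>r\<close>, which is at most 1,
    and the right side the \<open>\<beta>\<close>-sum of \<open>r\<close> against itself, which is
    1.\<close>
  moreover have "V * (\<Sum>x\<in>S. p x powr a * tA x) powr k \<le> (\<Sum>x\<in>S. r x powr b * tA x powr k)"
  proof -
    have "(\<Sum>x\<in>S. p x powr a * tA x) = \<kappa> powr (1 - a) * (\<Sum>x\<in>S. p x powr a * r x powr (1 - a))"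
      by (simp add: tA_def powr_mult sum_distrib_left mult_ac)
    also have "\<dots> \<le> \<kappa> powr (1 - a) * 1"
      using assms r0 sr by (intro mult_left_mono renyi_sum_le_1) auto
    finally have "(\<Sum>x\<in>S. p x powr a * tA x) powr k \<le> (\<kappa> powr (1 - a)) powr k"
      using k0 by (intro powr_mono2) (auto simp: tA_def intro!: sum_nonneg)
    then have "V * (\<Sum>x\<in>S. p x powr a * tA x) powr k \<le> 1 * \<kappa> powr (1 - b)"
      using V by (intro mult_mono) (auto simp: powr_powr kk)
    also have "\<dots> = \<kappa> powr (1 - b) * (\<Sum>x\<in>S. r x powr b * r x powr (1 - b))"
      using sr r0 by (simp flip: powr_add)
    also have "\<dots> = (\<Sum>x\<in>S. r x powr b * tA x powr k)"
      by (simp add: tA_def powr_mult powr_powr kk' sum_distrib_left mult_ac)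
    finally show ?thesis .
  qed
  ultimately have "V * ((\<Sum>x\<in>S. p x powr a * tA x) + (\<Sum>x\<in>S. p x powr a * tB x)) powr k
      \<le> (\<Sum>x\<in>S. r x powr b * (tA x + tB x) powr k)"
    using k0 tB0 by (intro sum_powr_superadditive) (auto simp: tA_def intro!: sum_nonneg)
  moreover have "(\<Sum>x\<in>S. p x powr a * tA x) + (\<Sum>x\<in>S. p x powr a * tB x) = (\<Sum>x\<in>S. p x powr a * q x powr (1 - a))"
    by (simp add: tB_def algebra_simps flip: sum.distrib)
  moreover have "(tA x + tB x) powr k = q x powr (1 - b)" for x
    by (simp add: tB_def powr_powr kk)
  ultimately show ?thesis
    using r0 sr loss by (intro that[of r]) auto
qed

section \<open>Positive semidefinite forms\<close>

text \<open>Entries form a function of two indices cut off at \<open>n\<close>, so that contractions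
  of block matrices need no carrier and the induction from \<open>n\<close> to \<open>Suc n\<close>
  needs no resizing.\<close>

definition psd_form :: "nat \<Rightarrow> (nat \<Rightarrow> nat \<Rightarrow> complex) \<Rightarrow> bool" where
  "psd_form n a \<longleftrightarrow> (\<forall>f. 0 \<le> (\<Sum>i<n. \<Sum>j<n. a i j * f j * cnj (f i)))"

lemma psd_mat_iff_psd_form:
  "psd_mat n A \<longleftrightarrow> A \<in> carrier_mat n n \<and> psd_form n (\<lambda>i j. A $$ (i, j))"
proof -
  have *: "(A *\<^sub>v v) \<bullet>c v = (\<Sum>i<n. \<Sum>j<n. A $$ (i, j) * v $ j * cnj (v $ i))"
    if "A \<in> carrier_mat n n" "v \<in> carrier_vec n" for v
    using that by (auto simp: scalar_prod_def atLeast0LessThan sum_distrib_right intro!: sum.cong)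
  show ?thesis
  proof (intro iffI conjI)
    assume A: "psd_mat n A"
    then show "A \<in> carrier_mat n n" by (simp add: psd_mat_def)
    show "psd_form n (\<lambda>i j. A $$ (i, j))"
      unfolding psd_form_def
    proof
      fix f :: "nat \<Rightarrow> complex"
      have "0 \<le> (A *\<^sub>v vec n f) \<bullet>c vec n f"
        using A by (simp add: psd_mat_def)
      then show "0 \<le> (\<Sum>i<n. \<Sum>j<n. A $$ (i, j) * f j * cnj (f i))"
        using A by (subst (asm) *) (auto simp: psd_mat_def)
    qed
  next
    assume "A \<in> carrier_mat n n \<and> psd_form n (\<lambda>i j. A $$ (i, j))"
    then show "psd_mat n A"
      using * by (auto simp: psd_mat_def psd_form_def)
  qed
qed

lemma psd_form_two_point:
  assumes "psd_form n a" "i < n" "j < n" "i \<noteq> j"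
  shows "0 \<le> a i i * s * cnj s + a i j * t * cnj s + (a j i * s * cnj t + a j j * t * cnj t)"
proof -
  define f where "f l = (if l = i then s else if l = j then t else 0)" for l
  have sum2: "(\<Sum>l<n. g l * f l) = g i * s + g j * t" for g :: "nat \<Rightarrow> complex"
  proof -
    have "(\<Sum>l<n. g l * f l) = (\<Sum>l\<in>{i, j}. g l * f l)"
      using assms by (intro sum.mono_neutral_right) (auto simp: f_def)
    then show ?thesis using assms by (simp add: f_def)
  qed
  have sum2': "(\<Sum>l<n. g l * cnj (f l)) = g i * cnj s + g j * cnj t" for g :: "nat \<Rightarrow> complex"
  proof -
    have "(\<Sum>l<n. g l * cnj (f l)) = (\<Sum>l\<in>{i, j}. g l * cnj (f l))"
      using assms by (intro sum.mono_neutral_right) (auto simp: f_def)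
    then show ?thesis using assms by (simp add: f_def)
  qed
  have "0 \<le> (\<Sum>i<n. \<Sum>j<n. a i j * f j * cnj (f i))"
    using assms by (simp add: psd_form_def)
  then show ?thesis
    unfolding sum_distrib_right[symmetric] sum2 sum2' by (simp add: algebra_simps)
qed

lemma psd_form_diag:
  assumes "psd_form n a" "i < n"
  shows "0 \<le> a i i"
proof -
  have "(\<Sum>l<n. a i' l * (if l = i then 1 else 0)) = a i' i" for i'
    using assms by (simp add: if_distrib cong: if_cong)
  moreover have "(\<Sum>i'<n. a i' i * cnj (if i' = i then 1 else 0)) = a i i"
    using assms by (simp add: if_distrib cong: if_cong)
  moreover have "0 \<le> (\<Sum>i'<n. \<Sum>l<n. a i' l * (if l = i then 1 else 0) * cnj (if i' = i then 1 else 0))"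
    using assms unfolding psd_form_def by (elim allE)
  ultimately show ?thesis
    by (simp flip: sum_distrib_right)
qed

text \<open>Reality of the form at the test vectors with entries \<open>(1, 1)\<close> and
  \<open>(1, \<i>)\<close> determines the imaginary and the real part of
  \<open>a j i\<close>.\<close>

lemma psd_form_hermitian:
  assumes "psd_form n a" "i < n" "j < n"
  shows "a j i = cnj (a i j)"
proof (cases "i = j")
  case True
  then show ?thesis
    using psd_form_diag[OF assms(1,2)] by (simp add: complex_eq_iff less_eq_complex_def)
next
  case False
  have "Im (a i i) = 0" "Im (a j j) = 0"
    using psd_form_diag[OF assms(1,2)] psd_form_diag[OF assms(1,3)] by (simp_all add: less_eq_complex_def)
  moreover have "Im (a i i + a i j + (a j i + a j j)) = 0"
    using psd_form_two_point[OF assms False, of 1 1] by (simp add: less_eq_complex_def)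
  moreover have "Im (a i i + a i j * \<i> + (a j i * cnj \<i> + a j j)) = 0"
    using psd_form_two_point[OF assms False, of 1 \<i>] by (simp add: less_eq_complex_def)
  ultimately show ?thesis
    by (simp add: complex_eq_iff)
qed

text \<open>In the direction of \<open>j\<close> the quadratic term is missing, so a nonzero linear
  term would make the form negative.\<close>

lemma psd_form_zero_diag:
  assumes "psd_form n a" "i < n" "j < n" "a j j = 0"
  shows "a i j = 0"
proof (cases "i = j")
  case False
  \<comment> \<open>Scaled so that the linear term exceeds \<open>Re (a i i)\<close> by 1 unless
    \<open>a i j = 0\<close>.\<close>
  define x where "x = (Re (a i i) + 1) / 2 / (cmod (a i j))\<^sup>2"
  have aii: "0 \<le> Re (a i i)"
    using psd_form_diag[OF assms(1,2)] by (simp add: less_eq_complex_def)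
  have herm: "a j i = cnj (a i j)"
    using psd_form_hermitian assms by blast
  have "0 \<le> Re (a i i * 1 * cnj 1 + a i j * (- x * cnj (a i j)) * cnj 1
      + (a j i * 1 * cnj (- x * cnj (a i j)) + a j j * (- x * cnj (a i j)) * cnj (- x * cnj (a i j))))"
    using psd_form_two_point[OF assms(1-3) False, of 1 "- x * cnj (a i j)"]
    unfolding less_eq_complex_def by simp
  then have le: "2 * x * (cmod (a i j))\<^sup>2 \<le> Re (a i i)"
    using assms(4) by (simp add: herm cmod_def power2_eq_square algebra_simps)
  show ?thesis
  proof (rule ccontr)
    assume "a i j \<noteq> 0"
    then have "2 * x * (cmod (a i j))\<^sup>2 = Re (a i i) + 1" by (simp add: x_def)
    then show False using le by simp
  qed
qed (use assms in simp)

text \<open>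
  Cholesky decomposition: the last index is eliminated by passing to the Schur complement.  If the last
  diagonal entry vanishes, so do its row and column, and \<open>x / 0 = 0\<close> gives the right complement.
\<close>
lemma psd_form_gram:
  assumes "psd_form n a"
  shows "\<exists>w. \<forall>i<n. \<forall>j<n. a i j = (\<Sum>l<n. w l i * cnj (w l j))"
  using assms
proof (induction n arbitrary: a)
  case (Suc n)
  define a' where "a' i j = a i j - a i n * a n j / a n n" for i j
  have d: "0 \<le> Re (a n n)" "Im (a n n) = 0"
    using psd_form_diag[OF Suc.prems, of n] by (simp_all add: less_eq_complex_def)
  have zero: "a i n = 0" "a n i = 0" if "i \<le> n" "a n n = 0" for i
    using psd_form_zero_diag[OF Suc.prems, of i n] psd_form_hermitian[OF Suc.prems, of i n] that by auto
  have "psd_form n a'"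
    unfolding psd_form_def
  proof
    fix f :: "nat \<Rightarrow> complex"
    define z where "z = (\<Sum>j<n. a n j * f j)"
    define z' where "z' = (\<Sum>i<n. a i n * cnj (f i))"
    \<comment> \<open>The last coordinate that completes the square: the form of \<open>a\<close> at
      \<open>g\<close> is the form of \<open>a'\<close> at \<open>f\<close>. If
      \<open>a n n = 0\<close>, then \<open>z = 0\<close> and the coordinate is 0.\<close>
    define g where "g = f(n := - z / a n n)"
    have z': "z' = cnj z"
      unfolding z_def z'_def using psd_form_hermitian[OF Suc.prems, of n] by (auto intro!: sum.cong)
    have z0: "z = 0" if "a n n = 0"
      unfolding z_def using zero that by (intro sum.neutral) auto
    have gn: "g n = - z / a n n" "\<And>i. i < n \<Longrightarrow> g i = f i" by (auto simp: g_def)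
    have cd: "cnj (a n n) = a n n" using d by (simp add: complex_eq_iff)
    have "(\<Sum>i<Suc n. \<Sum>j<Suc n. a i j * g j * cnj (g i))
        = (\<Sum>i<n. \<Sum>j<n. a i j * f j * cnj (f i)) + z' * g n + z * cnj (g n) + a n n * g n * cnj (g n)"
    proof -
      have "(\<Sum>i<n. \<Sum>j<n. a i j * g j * cnj (g i)) = (\<Sum>i<n. \<Sum>j<n. a i j * f j * cnj (f i))"
        by (intro sum.cong refl) (simp add: gn(2))
      moreover have "(\<Sum>i<n. a i n * g n * cnj (g i)) = z' * g n"
        unfolding z'_def sum_distrib_right by (intro sum.cong refl) (simp add: gn(2))
      moreover have "(\<Sum>j<n. a n j * g j * cnj (g n)) = z * cnj (g n)"
        unfolding z_def sum_distrib_right by (intro sum.cong refl) (simp add: gn(2))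
      ultimately show ?thesis by (simp add: sum.distrib)
    qed
    also have "\<dots> = (\<Sum>i<n. \<Sum>j<n. a i j * f j * cnj (f i)) - z' * z / a n n"
    proof (cases "a n n = 0")
      case False
      have "cnj (g n) = - cnj z / a n n" by (simp add: gn(1) cd)
      moreover have "a n n * g n = - z" using False by (simp add: gn(1))
      ultimately show ?thesis unfolding z' by (simp add: gn(1) mult.commute)
    qed (simp add: z0 z')
    also have "\<dots> = (\<Sum>i<n. \<Sum>j<n. a' i j * f j * cnj (f i))"
      unfolding z_def z'_def a'_def sum_product sum_divide_distrib sum_subtractf[symmetric]
      by (intro sum.cong refl) (simp add: algebra_simps)
    finally have "(\<Sum>i<Suc n. \<Sum>j<Suc n. a i j * g j * cnj (g i)) = (\<Sum>i<n. \<Sum>j<n. a' i j * f j * cnj (f i))" .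
    moreover have "0 \<le> (\<Sum>i<Suc n. \<Sum>j<Suc n. a i j * g j * cnj (g i))"
      using Suc.prems unfolding psd_form_def by (rule spec)
    ultimately show "0 \<le> (\<Sum>i<n. \<Sum>j<n. a' i j * f j * cnj (f i))"
      by (simp only:)
  qed
  then obtain w where w: "\<And>i j. i < n \<Longrightarrow> j < n \<Longrightarrow> a' i j = (\<Sum>l<n. w l i * cnj (w l j))"
    using Suc.IH by blast
  \<comment> \<open>The vectors for \<open>a'\<close> are padded with 0 at index \<open>n\<close>;
    the new one restores the rank-one term subtracted in \<open>a'\<close>.\<close>
  define w' where "w' l i = (if l < n then if i < n then w l i else 0 else a i n / complex_of_real (sqrt (Re (a n n))))" for l i
  have dd: "complex_of_real (sqrt (Re (a n n))) * complex_of_real (sqrt (Re (a n n))) = a n n"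
    using d by (simp flip: of_real_mult add: complex_eq_iff)
  have "a i j = (\<Sum>l<Suc n. w' l i * cnj (w' l j))" if "i < Suc n" "j < Suc n" for i j
  proof -
    have last: "w' n i * cnj (w' n j) = a i n * a n j / a n n"
      using psd_form_hermitian[OF Suc.prems that(2), of n] by (simp add: w'_def dd)
    show ?thesis
    proof (cases "i < n \<and> j < n")
      case True
      then have "(\<Sum>l<n. w' l i * cnj (w' l j)) = a' i j"
        using w by (simp add: w'_def)
      then show ?thesis using last by (simp add: a'_def)
    next
      case False
      then have "(\<Sum>l<n. w' l i * cnj (w' l j)) = 0" by (auto simp: w'_def intro!: sum.neutral)
      moreover have "a i j = a i n * a n j / a n n"
        using False that zero[of i] zero[of j] by (cases "a n n = 0") (auto simp: less_Suc_eq)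
      ultimately show ?thesis using last by simp
    qed
  qed
  then show ?case by blast
qed simp

text \<open>A Gram decomposition of \<open>a\<close> writes the trace as a sum of values of the form
  \<open>b\<close>.\<close>

lemma psd_form_trace_mult:
  assumes "psd_form n a" "psd_form n b"
  shows "0 \<le> (\<Sum>i<n. \<Sum>j<n. a i j * b j i)"
proof -
  obtain w where w: "\<And>i j. i < n \<Longrightarrow> j < n \<Longrightarrow> a i j = (\<Sum>l<n. w l i * cnj (w l j))"
    using psd_form_gram[OF assms(1)] by blast
  have "(\<Sum>i<n. \<Sum>j<n. a i j * b j i) = (\<Sum>i<n. \<Sum>j<n. \<Sum>l<n. b j i * w l i * cnj (w l j))"
    by (intro sum.cong refl) (simp add: w sum_distrib_left mult_ac)
  also have "\<dots> = (\<Sum>j<n. \<Sum>i<n. \<Sum>l<n. b j i * w l i * cnj (w l j))"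
    by (rule sum.swap)
  also have "\<dots> = (\<Sum>j<n. \<Sum>l<n. \<Sum>i<n. b j i * w l i * cnj (w l j))"
    by (intro sum.cong refl sum.swap)
  also have "\<dots> = (\<Sum>l<n. \<Sum>j<n. \<Sum>i<n. b j i * w l i * cnj (w l j))"
    by (rule sum.swap)
  finally show ?thesis
    using assms(2) by (simp add: psd_form_def sum_nonneg)
qed

section \<open>Reduction to probability vectors\<close>

lemma sum_lessThan_mult:
  fixes g :: "nat \<Rightarrow> 'a::comm_monoid_add"
  shows "(\<Sum>i<k * m. g i) = (\<Sum>a<k. \<Sum>x<m. g (a * m + x))"
proof -
  have "(\<Sum>i<k * m. g i) = (\<Sum>a<k. sum g {a * m..<a * m + m})"
    by (rule sum.nat_group[symmetric])
  also have "\<dots> = (\<Sum>a<k. \<Sum>x<m. g (a * m + x))"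
  proof (rule sum.cong[OF refl])
    fix a
    show "sum g {a * m..<a * m + m} = (\<Sum>x<m. g (a * m + x))"
      using sum.shift_bounds_nat_ivl[of g 0 "a * m" m]
      by (simp add: atLeast0LessThan add.commute)
  qed
  finally show ?thesis .
qed

lemma sum_delta_mult:
  fixes g h :: "nat \<Rightarrow> 'a::semiring_0"
  assumes "x < m"
  shows "(\<Sum>y<m. (if x = y then h y else 0) * g y) = h x * g x"
proof -
  have "(\<Sum>y<m. (if x = y then h y else 0) * g y) = (\<Sum>y<m. if x = y then h x * g x else 0)"
    by (intro sum.cong) auto
  then show ?thesis using assms by simp
qed

lemma mtrace_mat_diag: "mtrace (mat_diag n h) = (\<Sum>x<n. h x)"
  by (simp add: mtrace_def mat_diag_def)

lemma mtrace_mult: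
  assumes "A \<in> carrier_mat n n" "B \<in> carrier_mat n n"
  shows "mtrace (A * B) = (\<Sum>i<n. \<Sum>j<n. A $$ (i, j) * B $$ (j, i))"
  using assms by (auto simp: mtrace_def scalar_prod_def atLeast0LessThan intro!: sum.cong)

lemma povm_carrier: "povm n m M \<Longrightarrow> x < m \<Longrightarrow> M x \<in> carrier_mat n n"
  by (simp add: povm_def psd_mat_def)

lemma povm_sum:
  assumes "povm n m M" "i < n" "j < n"
  shows "(\<Sum>x<m. M x $$ (i, j)) = (if i = j then 1 else 0)"
proof -
  have "mat n n (\<lambda>ij. \<Sum>x<m. M x $$ ij) $$ (i, j) = 1\<^sub>m n $$ (i, j)"
    using assms by (simp add: povm_def)
  then show ?thesis using assms by simp
qed

lemma povm_sum_mtrace: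
  assumes "povm n m M" "A \<in> carrier_mat n n"
  shows "(\<Sum>x<m. mtrace (M x * A)) = mtrace A"
proof -
  have "(\<Sum>x<m. mtrace (M x * A)) = (\<Sum>x<m. \<Sum>i<n. \<Sum>j<n. M x $$ (i, j) * A $$ (j, i))"
    using assms by (intro sum.cong refl mtrace_mult[OF povm_carrier[OF assms(1)]]) auto
  also have "\<dots> = (\<Sum>i<n. \<Sum>x<m. \<Sum>j<n. M x $$ (i, j) * A $$ (j, i))"
    by (rule sum.swap)
  also have "\<dots> = (\<Sum>i<n. \<Sum>j<n. \<Sum>x<m. M x $$ (i, j) * A $$ (j, i))"
    by (intro sum.cong refl sum.swap)
  also have "\<dots> = (\<Sum>i<n. \<Sum>j<n. (if i = j then 1 else 0) * A $$ (j, i))"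
    using povm_sum[OF assms(1)] by (intro sum.cong refl) (simp flip: sum_distrib_right)
  also have "\<dots> = mtrace A"
    using assms(2) by (simp add: mtrace_def if_distrib if_distribR cong: if_cong)
  finally show ?thesis .
qed

section \<open>Measurements as completely positive maps\<close>

definition measurement_channel :: "nat \<Rightarrow> (nat \<Rightarrow> complex mat) \<Rightarrow> complex mat \<Rightarrow> complex mat" where
  "measurement_channel m M X = mat_diag m (\<lambda>x. mtrace (M x * X))"

text \<open>The output is diagonal in the outcome index, so its form at \<open>f\<close> is the sum
  over outcomes \<open>x\<close> of the trace of \<open>M x\<close> against \<open>Y x\<close>, the
  contraction of \<open>X\<close> with the components of \<open>f\<close> belonging to
  \<open>x\<close>. Both factors are positive.\<close>

lemma measurement_channel_ampliation_psd:
  assumes M: "povm n m M" and X: "psd_mat (k * n) X"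
  shows "psd_mat (k * m) (ampliation k n m (measurement_channel m M) X)"
proof -
  define B where "B a b = mat n n (\<lambda>(s, t). X $$ (a * n + s, b * n + t))" for a b
  have B: "B a b \<in> carrier_mat n n" for a b by (simp add: B_def)
  let ?A = "ampliation k n m (measurement_channel m M) X"
  have entry: "?A $$ (a * m + x, b * m + y) = (if x = y then mtrace (M x * B a b) else 0)"
    if "a < k" "b < k" "x < m" "y < m" for a b x y
  proof -
    have lt: "c * m + z < k * m" if "c < k" "z < m" for c z
    proof -
      have "c * m + z < Suc c * m" using that by simp
      also have "\<dots> \<le> k * m" using that by (intro mult_le_mono1) auto
      finally show ?thesis .
    qed
    show ?thesis
      using that lt by (simp add: ampliation_def measurement_channel_def mat_diag_def B_def)
  qed
  have "psd_form (k * m) (\<lambda>i j. ?A $$ (i, j))"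
    unfolding psd_form_def
  proof
    fix f :: "nat \<Rightarrow> complex"
    define Y where "Y x s t = (\<Sum>a<k. \<Sum>b<k. f (b * m + x) * cnj (f (a * m + x)) * X $$ (a * n + s, b * n + t))" for x s t
    have Y: "psd_form n (Y x)" for x
      unfolding psd_form_def
    proof
      fix g :: "nat \<Rightarrow> complex"
      \<comment> \<open>A product vector: the form \<open>Y x\<close> at \<open>g\<close> is the
        form of \<open>X\<close> at \<open>h\<close>.\<close>
      define h where "h i = f ((i div n) * m + x) * g (i mod n)" for i
      have "(\<Sum>s<n. \<Sum>t<n. Y x s t * g t * cnj (g s))
          = (\<Sum>s<n. \<Sum>t<n. \<Sum>a<k. \<Sum>b<k. X $$ (a * n + s, b * n + t) * h (b * n + t) * cnj (h (a * n + s)))"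
        by (intro sum.cong refl) (simp add: Y_def h_def sum_distrib_left sum_distrib_right mult_ac)
      also have "\<dots> = (\<Sum>s<n. \<Sum>a<k. \<Sum>t<n. \<Sum>b<k. X $$ (a * n + s, b * n + t) * h (b * n + t) * cnj (h (a * n + s)))"
        by (intro sum.cong refl sum.swap)
      also have "\<dots> = (\<Sum>a<k. \<Sum>s<n. \<Sum>t<n. \<Sum>b<k. X $$ (a * n + s, b * n + t) * h (b * n + t) * cnj (h (a * n + s)))"
        by (rule sum.swap)
      also have "\<dots> = (\<Sum>a<k. \<Sum>s<n. \<Sum>b<k. \<Sum>t<n. X $$ (a * n + s, b * n + t) * h (b * n + t) * cnj (h (a * n + s)))"
        by (intro sum.cong refl sum.swap)
      also have "\<dots> = (\<Sum>i<k * n. \<Sum>j<k * n. X $$ (i, j) * h j * cnj (h i))"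
        by (simp add: sum_lessThan_mult)
      finally show "0 \<le> (\<Sum>s<n. \<Sum>t<n. Y x s t * g t * cnj (g s))"
        using X by (simp add: psd_mat_iff_psd_form psd_form_def)
    qed
    have "(\<Sum>i<k * m. \<Sum>j<k * m. ?A $$ (i, j) * f j * cnj (f i))
        = (\<Sum>a<k. \<Sum>x<m. \<Sum>b<k. \<Sum>y<m. (if x = y then mtrace (M x * B a b) else 0) * f (b * m + y) * cnj (f (a * m + x)))"
      unfolding sum_lessThan_mult by (intro sum.cong refl) (simp add: entry)
    also have "\<dots> = (\<Sum>a<k. \<Sum>x<m. \<Sum>b<k. mtrace (M x * B a b) * f (b * m + x) * cnj (f (a * m + x)))"
      by (intro sum.cong refl) (simp add: sum_delta_mult mult.assoc)
    also have "\<dots> = (\<Sum>x<m. \<Sum>a<k. \<Sum>b<k. mtrace (M x * B a b) * f (b * m + x) * cnj (f (a * m + x)))"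
      by (rule sum.swap)
    also have "\<dots> = (\<Sum>x<m. \<Sum>a<k. \<Sum>b<k. \<Sum>s<n. \<Sum>t<n.
        M x $$ (s, t) * (f (b * m + x) * cnj (f (a * m + x)) * X $$ (a * n + t, b * n + s)))"
    proof (intro sum.cong refl)
      fix x a b assume "x \<in> {..<m}"
      then have "mtrace (M x * B a b) = (\<Sum>s<n. \<Sum>t<n. M x $$ (s, t) * B a b $$ (t, s))"
        using povm_carrier[OF M] B by (intro mtrace_mult) auto
      also have "\<dots> = (\<Sum>s<n. \<Sum>t<n. M x $$ (s, t) * X $$ (a * n + t, b * n + s))"
        by (intro sum.cong refl) (simp add: B_def)
      finally show "mtrace (M x * B a b) * f (b * m + x) * cnj (f (a * m + x)) = (\<Sum>s<n. \<Sum>t<n.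
          M x $$ (s, t) * (f (b * m + x) * cnj (f (a * m + x)) * X $$ (a * n + t, b * n + s)))"
        by (simp add: sum_distrib_left sum_distrib_right mult_ac)
    qed
    also have "\<dots> = (\<Sum>x<m. \<Sum>s<n. \<Sum>t<n. M x $$ (s, t) * Y x t s)"
    proof (rule sum.cong[OF refl])
      fix x
      let ?g = "\<lambda>a b s t. M x $$ (s, t) * (f (b * m + x) * cnj (f (a * m + x)) * X $$ (a * n + t, b * n + s))"
      have "(\<Sum>a<k. \<Sum>b<k. \<Sum>s<n. \<Sum>t<n. ?g a b s t) = (\<Sum>a<k. \<Sum>s<n. \<Sum>b<k. \<Sum>t<n. ?g a b s t)"
        by (intro sum.cong refl sum.swap)
      also have "\<dots> = (\<Sum>s<n. \<Sum>a<k. \<Sum>b<k. \<Sum>t<n. ?g a b s t)"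
        by (rule sum.swap)
      also have "\<dots> = (\<Sum>s<n. \<Sum>a<k. \<Sum>t<n. \<Sum>b<k. ?g a b s t)"
        by (intro sum.cong refl sum.swap)
      also have "\<dots> = (\<Sum>s<n. \<Sum>t<n. \<Sum>a<k. \<Sum>b<k. ?g a b s t)"
        by (intro sum.cong refl sum.swap)
      also have "\<dots> = (\<Sum>s<n. \<Sum>t<n. M x $$ (s, t) * Y x t s)"
        by (simp add: Y_def sum_distrib_left)
      finally show "(\<Sum>a<k. \<Sum>b<k. \<Sum>s<n. \<Sum>t<n. ?g a b s t) = (\<Sum>s<n. \<Sum>t<n. M x $$ (s, t) * Y x t s)" .
    qed
    also have "0 \<le> \<dots>"
    proof (rule sum_nonneg)
      fix x assume "x \<in> {..<m}"
      then have "psd_form n (\<lambda>i j. M x $$ (i, j))"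
        using M by (simp add: povm_def psd_mat_iff_psd_form)
      then show "0 \<le> (\<Sum>s<n. \<Sum>t<n. M x $$ (s, t) * Y x t s)"
        using Y by (rule psd_form_trace_mult)
    qed
    finally show "0 \<le> (\<Sum>i<k * m. \<Sum>j<k * m. ?A $$ (i, j) * f j * cnj (f i))" .
  qed
  then show ?thesis
    by (simp add: psd_mat_iff_psd_form ampliation_def)
qed

lemma measurement_channel_cptp:
  assumes "povm n m M"
  shows "cptp n m (measurement_channel m M)"
proof -
  have M: "M x \<in> carrier_mat n n" if "x < m" for x
    using povm_carrier[OF assms that] .
  have add: "measurement_channel m M (A + B) = measurement_channel m M A + measurement_channel m M B"
    if "A \<in> carrier_mat n n" "B \<in> carrier_mat n n" for A B
  proof (intro eq_matI)
    fix i j assume "i < dim_row (measurement_channel m M A + measurement_channel m M B)"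
      "j < dim_col (measurement_channel m M A + measurement_channel m M B)"
    then have ij: "i < m" "j < m" by (auto simp: measurement_channel_def mat_diag_def)
    have "mtrace (M x * (A + B)) = mtrace (M x * A) + mtrace (M x * B)" if x: "x < m" for x
      using that M[OF x] \<open>A \<in> _\<close> \<open>B \<in> _\<close>
      by (simp add: mtrace_mult[of _ n] distrib_left sum.distrib)
    then show "measurement_channel m M (A + B) $$ (i, j)
        = (measurement_channel m M A + measurement_channel m M B) $$ (i, j)"
      using ij by (simp add: measurement_channel_def mat_diag_def)
  qed (simp_all add: measurement_channel_def mat_diag_def)
  have scale: "measurement_channel m M (c \<cdot>\<^sub>m A) = c \<cdot>\<^sub>m measurement_channel m M A"
    if "A \<in> carrier_mat n n" for A c
  proof (intro eq_matI)
    fix i j assume "i < dim_row (c \<cdot>\<^sub>m measurement_channel m M A)"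
      "j < dim_col (c \<cdot>\<^sub>m measurement_channel m M A)"
    then have ij: "i < m" "j < m" by (auto simp: measurement_channel_def mat_diag_def)
    have "mtrace (M x * (c \<cdot>\<^sub>m A)) = c * mtrace (M x * A)" if x: "x < m" for x
      using that M[OF x] \<open>A \<in> _\<close>
      by (simp add: mtrace_mult[of _ n] sum_distrib_left mult_ac)
    then show "measurement_channel m M (c \<cdot>\<^sub>m A) $$ (i, j) = (c \<cdot>\<^sub>m measurement_channel m M A) $$ (i, j)"
      using ij by (simp add: measurement_channel_def mat_diag_def)
  qed (simp_all add: measurement_channel_def mat_diag_def)
  have trace: "mtrace (measurement_channel m M A) = mtrace A" if "A \<in> carrier_mat n n" for A
    using povm_sum_mtrace[OF assms that] by (simp add: measurement_channel_def mtrace_mat_diag)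
  show ?thesis
    unfolding cptp_def
    using add scale trace measurement_channel_ampliation_psd[OF assms]
    by (auto simp: measurement_channel_def)
qed

lemma psd_mat_trace_mult:
  assumes "psd_mat n A" "psd_mat n B"
  shows "0 \<le> mtrace (A * B)"
  using assms psd_form_trace_mult by (auto simp: psd_mat_iff_psd_form mtrace_mult)

lemma measure_povm_prob_vec:
  assumes "povm n m M" "\<rho> \<in> density n"
  shows "measure_povm m M \<rho> \<in> prob_vec m"
proof -
  have \<rho>: "psd_mat n \<rho>" "\<rho> \<in> carrier_mat n n" "mtrace \<rho> = 1"
    using assms by (auto simp: density_def psd_mat_def)
  have "0 \<le> Re (mtrace (M x * \<rho>))" if "x < m" for x
    using psd_mat_trace_mult[OF _ \<rho>(1), of "M x"] assms that by (simp add: povm_def less_eq_complex_def)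
  moreover have "(\<Sum>x<m. Re (mtrace (M x * \<rho>))) = 1"
    using povm_sum_mtrace[OF assms(1) \<rho>(2)] \<rho>(3) by (simp flip: Re_sum)
  ultimately show ?thesis
    by (simp add: prob_vec_def measure_povm_def)
qed

lemma unitary_mat_one: "unitary_mat n (1\<^sub>m n)"
  and diag_state_one: "p \<in> carrier_vec n \<Longrightarrow>
    diag_state (1\<^sub>m n) p = mat_diag n (\<lambda>x. complex_of_real (p $ x))"
proof -
  have "mat_adjoint (1\<^sub>m n) = (1\<^sub>m n :: complex mat)"
    by (intro eq_matI) (auto simp: mat_adjoint_def mat_of_rows_index)
  then show "unitary_mat n (1\<^sub>m n)" and "p \<in> carrier_vec n \<Longrightarrow>
    diag_state (1\<^sub>m n) p = mat_diag n (\<lambda>x. complex_of_real (p $ x))"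
    by (simp_all add: unitary_mat_def diag_state_def left_mult_one_mat[OF mat_diag_dim] right_mult_one_mat[OF mat_diag_dim])
qed

text \<open>Traces of products of positive matrices are real, so the \<open>Re\<close> in
  \<open>measure_povm\<close> loses nothing, and the identity serves as the diagonalising
  unitary.\<close>

lemma measurement_channel_eq_diag_state:
  assumes "povm n m M" "\<rho> \<in> density n"
  shows "measurement_channel m M \<rho> = diag_state (1\<^sub>m m) (measure_povm m M \<rho>)"
proof -
  have "mtrace (M x * \<rho>) = complex_of_real (Re (mtrace (M x * \<rho>)))" if "x < m" for x
    using psd_mat_trace_mult[of n "M x" \<rho>] assms that
    by (simp add: povm_def density_def less_eq_complex_def complex_eq_iff)
  then have "measurement_channel m M \<rho> = mat_diag m (\<lambda>x. complex_of_real (measure_povm m M \<rho> $ x))"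
    by (intro eq_matI) (auto simp: measurement_channel_def measure_povm_def mat_diag_def)
  then show ?thesis
    by (simp add: diag_state_one measure_povm_def)
qed

lemma quantum_extension_measured_le:
  assumes "quantum_extension Dc D" "povm n m M" "\<rho> \<in> density n" "\<sigma> \<in> density n"
  shows "Dc (measure_povm m M \<rho>) (measure_povm m M \<sigma>) \<le> D \<rho> \<sigma>"
proof -
  have "D (measurement_channel m M \<rho>) (measurement_channel m M \<sigma>) \<le> D \<rho> \<sigma>"
    using assms measurement_channel_cptp[OF assms(2)]
    unfolding quantum_extension_def quantum_divergence_def by blast
  moreover have "D (diag_state (1\<^sub>m m) (measure_povm m M \<rho>)) (diag_state (1\<^sub>m m) (measure_povm m M \<sigma>))
      = Dc (measure_povm m M \<rho>) (measure_povm m M \<sigma>)"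
    using assms unitary_mat_one[of m] measure_povm_prob_vec[OF assms(2)]
    unfolding quantum_extension_def by blast
  ultimately show ?thesis
    using assms by (simp add: measurement_channel_eq_diag_state)
qed

lemma mu_sub_leI:
  assumes "quantum_extension (renyi_div \<alpha>) D"
    and le: "\<And>d p q. p \<in> prob_vec d \<Longrightarrow> q \<in> prob_vec d \<Longrightarrow>
      smoothed_renyi_div \<epsilon> \<beta> p q \<le> renyi_div \<alpha> p q + \<mu>"
  shows "mu_sub \<epsilon> \<beta> D \<le> \<mu>"
proof -
  have "measured_div (smoothed_renyi_div \<epsilon> \<beta>) \<rho> \<sigma> \<le> D \<rho> \<sigma> + \<mu>"
    if \<rho>: "\<rho> \<in> density n" and \<sigma>: "\<sigma> \<in> density n" for n \<rho> \<sigma>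
    unfolding measured_div_def
  proof (intro SUP_least, clarify)
    fix m M assume "povm (dim_row \<rho>) m M"
    moreover have "dim_row \<rho> = n" using \<rho> by (auto simp: density_def psd_mat_def)
    ultimately have M: "povm n m M" by simp
    have "smoothed_renyi_div \<epsilon> \<beta> (measure_povm m M \<rho>) (measure_povm m M \<sigma>)
        \<le> renyi_div \<alpha> (measure_povm m M \<rho>) (measure_povm m M \<sigma>) + \<mu>"
      by (rule le[OF measure_povm_prob_vec[OF M \<rho>] measure_povm_prob_vec[OF M \<sigma>]])
    also have "\<dots> \<le> D \<rho> \<sigma> + \<mu>"
      using quantum_extension_measured_le[OF assms(1) M \<rho> \<sigma>] by (rule add_right_mono)
    finally show "smoothed_renyi_div \<epsilon> \<beta> (measure_povm m M \<rho>) (measure_povm m M \<sigma>) \<le> D \<rho> \<sigma> + \<mu>" .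
  qed
  then show ?thesis
    using assms(1) by (subst mu_sub_le_iff) (auto simp: quantum_extension_def)
qed

text \<open>A finite divergence keeps the pair in the index set of the supremum. Diagonal states
  measured in their own basis return \<open>p\<close> and \<open>q\<close>, which bounds the
  measured quantity from below.\<close>

lemma le_mu_subI:
  assumes ext: "quantum_extension (renyi_div \<alpha>) D"
    and p: "p \<in> prob_vec d" and q: "q \<in> prob_vec d"
    and D: "renyi_div \<alpha> p q = ereal x" and le: "ereal (x + y) \<le> smoothed_renyi_div \<epsilon> \<beta> p q"
  shows "ereal y \<le> mu_sub \<epsilon> \<beta> D"
proof -
  define s where "s r = diag_state (1\<^sub>m d) r" for r
  have s: "s r = mat_diag d (\<lambda>x. complex_of_real (r $ x))" if "r \<in> prob_vec d" for r
    unfolding s_def using that by (intro diag_state_one) (simp add: prob_vec_def)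
  have diag_form: "(\<Sum>i<d. \<Sum>j<d. mat_diag d h $$ (i, j) * f j * cnj (f i)) = (\<Sum>i<d. h i * (f i * cnj (f i)))"
    for h :: "nat \<Rightarrow> complex" and f
    by (intro sum.cong refl) (simp add: mat_diag_def sum_delta_mult mult.assoc)
  have psd_diag: "psd_mat d (mat_diag d h)" if "\<And>i. i < d \<Longrightarrow> 0 \<le> h i" for h :: "nat \<Rightarrow> complex"
    unfolding psd_mat_iff_psd_form psd_form_def diag_form
    using that by (auto intro!: sum_nonneg mult_nonneg_nonneg simp: complex_mult_cnj less_eq_complex_def)
  have density: "s r \<in> density d" if r: "r \<in> prob_vec d" for r
  proof -
    have "mtrace (s r) = complex_of_real (\<Sum>x<d. r $ x)"
      by (simp add: s[OF r] mtrace_mat_diag)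
    also have "\<dots> = 1"
      using r by (simp only: prob_vec_def mem_Collect_eq of_real_1)
    finally have "mtrace (s r) = 1" .
    then show ?thesis
      using r psd_diag[of "\<lambda>x. complex_of_real (r $ x)"]
      by (simp add: density_def s[OF r] prob_vec_def less_eq_complex_def)
  qed
  define M where "M x = mat_diag d (\<lambda>i. if i = x then 1 else 0 :: complex)" for x
  have M: "povm d d M"
    unfolding povm_def
  proof (intro conjI allI impI)
    show "psd_mat d (M x)" for x
      unfolding M_def by (intro psd_diag) (auto simp: less_eq_complex_def)
    show "mat d d (\<lambda>ij. \<Sum>x<d. M x $$ ij) = 1\<^sub>m d"
      by (intro eq_matI) (auto simp: M_def mat_diag_def)
  qed
  have measure: "measure_povm d M (s r) = r" if r: "r \<in> prob_vec d" for r
  proof (intro eq_vecI)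
    fix x assume "x < dim_vec r"
    then have x: "x < d" using r by (auto simp: prob_vec_def)
    have "M x * s r = mat_diag d (\<lambda>i. if i = x then complex_of_real (r $ x) else 0)"
      unfolding M_def s[OF r] mat_diag_diag by (intro arg_cong[of _ _ "mat_diag d"]) auto
    then show "measure_povm d M (s r) $ x = r $ x"
      using x by (simp add: measure_povm_def mtrace_mat_diag)
  qed (use r in \<open>auto simp: measure_povm_def prob_vec_def\<close>)
  have "D (s p) (s q) = ereal x"
    using ext p q D unitary_mat_one[of d] by (simp add: quantum_extension_def s_def)
  moreover have "ereal (x + y) \<le> measured_div (smoothed_renyi_div \<epsilon> \<beta>) (s p) (s q)"
  proof -
    have "(d, M) \<in> {(m, M). povm (dim_row (s p)) m M}"
      using M by (simp add: s[OF p] mat_diag_def)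
    then have "smoothed_renyi_div \<epsilon> \<beta> (measure_povm d M (s p)) (measure_povm d M (s q))
        \<le> measured_div (smoothed_renyi_div \<epsilon> \<beta>) (s p) (s q)"
      unfolding measured_div_def by (rule SUP_upper2) simp
    then show ?thesis using le measure p q by simp
  qed
  ultimately have "ereal (x + y) - ereal x \<le> measured_div (smoothed_renyi_div \<epsilon> \<beta>) (s p) (s q) - D (s p) (s q)"
    by (intro ereal_minus_mono) auto
  also have "\<dots> \<le> mu_sub \<epsilon> \<beta> D"
    unfolding mu_sub_def using density p q \<open>D (s p) (s q) = ereal x\<close>
    by (intro SUP_upper2[of "(s p, s q)"]) auto
  finally show ?thesis by simp
qed

section \<open>The optimal constants\<close>

lemma renyi_sum_pos:
  assumes "p \<in> carrier_vec d" "q \<in> carrier_vec d" "supp_vec p \<inter> supp_vec q \<noteq> {}"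
    "\<forall>x<d. 0 \<le> p $ x" "\<forall>x<d. 0 \<le> q $ x"
  shows "0 < (\<Sum>x<d. (p $ x) powr a * (q $ x) powr b)"
proof -
  obtain x where "x < d" "p $ x \<noteq> 0" "q $ x \<noteq> 0"
    using assms by (auto simp: supp_vec_def)
  then show ?thesis
    using assms by (intro sum_pos2[of _ x]) auto
qed

lemma supp_vec_nonempty:
  assumes "p \<in> carrier_vec d" "(\<Sum>x<d. p $ x) \<noteq> 0"
  shows "supp_vec p \<noteq> {}"
proof
  assume "supp_vec p = {}"
  then have "p $ x = 0" if "x < d" for x
    using that assms(1) by (auto simp: supp_vec_def)
  then show False using assms(2) by simp
qed

lemma smoothed_renyi_div_le:
  assumes "r \<in> subprob_vec (dim_vec p)" "(\<Sum>x<dim_vec p. max (p $ x - r $ x) 0) \<le> \<epsilon>"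
    "renyi_div \<beta> r q \<le> u"
  shows "smoothed_renyi_div \<epsilon> \<beta> p q \<le> u"
  unfolding smoothed_renyi_div_def using assms by (intro INF_lower2[of r]) auto

section \<open>Orders above 1\<close>

text \<open>The conditions on \<open>t\<close> amount to \<open>t = max \<epsilon> \<theta>\<close>,
  so one statement covers both regimes of the constant; \<open>c\<close> is
  \<open>b / (b - 1)\<close> or its limit 1.\<close>

lemma smoothed_le_renyi_div_add_gt_1:
  assumes p: "p \<in> prob_vec d" and q: "q \<in> prob_vec d"
    and \<epsilon>: "0 < \<epsilon>" "\<epsilon> < 1" and a: "1 < a"
    and t: "\<epsilon> \<le> t" "t < 1" "t = \<epsilon> \<or> t = \<theta>"
    and \<beta>: "\<beta> = ereal b \<and> a < b \<and> \<theta> = (b - a) / (a * (b - 1)) \<and> c = b / (b - 1)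
      \<or> \<beta> = \<infinity> \<and> \<theta> = 1 / a \<and> c = 1" and "\<theta> \<le> t"
  shows "smoothed_renyi_div \<epsilon> \<beta> p q
    \<le> renyi_div (ereal a) p q + ereal (c * log 2 (1 - t) + (c - a / (a - 1)) * log 2 (\<epsilon> / t))"
proof (cases "supp_vec p \<subseteq> supp_vec q")
  case False
  then show ?thesis using a by (simp add: renyi_div_def)
next
  case True
  have p': "p \<in> carrier_vec d" "\<And>x. x < d \<Longrightarrow> 0 \<le> p $ x" "(\<Sum>x<d. p $ x) = 1"
    and q': "q \<in> carrier_vec d" "\<And>x. x < d \<Longrightarrow> 0 \<le> q $ x"
    using p q by (auto simp: prob_vec_def)
  have pq: "0 < q $ x" if "x < d" "0 < p $ x" for x
  proof -
    have "x \<in> supp_vec p" using that p' by (simp add: supp_vec_def)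
    then show ?thesis using True q'(2)[OF that(1)] by (force simp: supp_vec_def)
  qed
  have "supp_vec p \<noteq> {}"
    using p' by (intro supp_vec_nonempty[of p d]) auto
  then have Q: "0 < (\<Sum>x<d. (p $ x) powr a * (q $ x) powr (1 - a))"
    using True p' q' by (intro renyi_sum_pos) auto
  define Q where "Q = (\<Sum>x<d. (p $ x) powr a * (q $ x) powr (1 - a))"
  have Da: "renyi_div (ereal a) p q = ereal (1 / (a - 1) * log 2 Q)"
    using True \<open>supp_vec p \<noteq> {}\<close> a p' by (simp add: renyi_div_def Q_def)
  obtain \<gamma> where \<gamma>: "0 < \<gamma>" "(\<Sum>x<d. min (p $ x) (\<gamma> * q $ x)) = 1 - \<epsilon>"
    using truncation_level_exists[of "{..<d}" "($) p" "($) q" \<epsilon>] p' q' pq \<epsilon> by auto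
  define r where "r = vec d (\<lambda>x. min (p $ x) (\<gamma> * q $ x))"
  have r: "r \<in> carrier_vec d" "\<And>x. x < d \<Longrightarrow> r $ x = min (p $ x) (\<gamma> * q $ x)"
    by (auto simp: r_def)
  have r0: "0 \<le> r $ x" if "x < d" for x
    using p'(2)[OF that] q'(2)[OF that] \<gamma> r(2)[OF that] by simp
  have sr: "(\<Sum>x<d. r $ x) = 1 - \<epsilon>"
    using \<gamma>(2) r(2) by simp
  have rq: "supp_vec r \<subseteq> supp_vec q"
    using True p' q' r \<gamma> by (auto simp: supp_vec_def subset_iff min_def split: if_splits)
  have rne: "supp_vec r \<noteq> {}"
    using sr \<epsilon> r by (intro supp_vec_nonempty[of r d]) auto
  have tp: "0 < t" using \<epsilon> t by simp
  show ?thesis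
  proof (rule smoothed_renyi_div_le)
    show "r \<in> subprob_vec (dim_vec p)"
      using p' r r0 sr \<epsilon> by (simp add: subprob_vec_def)
    have "(\<Sum>x<d. max (p $ x - r $ x) 0) = (\<Sum>x<d. p $ x - r $ x)"
      by (intro sum.cong) (auto simp: r(2))
    then show "(\<Sum>x<dim_vec p. max (p $ x - r $ x) 0) \<le> \<epsilon>"
      using p' sr by (simp add: sum_subtractf)
    show "renyi_div \<beta> r q
      \<le> renyi_div (ereal a) p q + ereal (c * log 2 (1 - t) + (c - a / (a - 1)) * log 2 (\<epsilon> / t))"
      using \<beta>
    proof (elim disjE conjE)
      assume \<beta>: "\<beta> = ereal b" "a < b" and \<theta>: "\<theta> = (b - a) / (a * (b - 1))" and c: "c = b / (b - 1)"
      define k where "k = (b - 1) / (a - 1)"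
      define R where "R = (\<Sum>x<d. (r $ x) powr b * (q $ x) powr (1 - b))"
      \<comment> \<open>\<open>\<theta>\<close> is the solution of
        \<open>(1 - t) * (k - 1) = b * t\<close>, the extreme case of the condition in
        \<open>truncation_pointwise\<close>; every \<open>t \<ge> \<theta>\<close> satisfies the
        inequality.\<close>
      have k1: "0 < k - 1" using \<beta> a by (simp add: k_def field_simps)
      have \<theta>k: "(1 - \<theta>) * (k - 1) = b * \<theta>"
      proof -
        have "(1 - \<theta>) = b * (a - 1) / (a * (b - 1))" "k - 1 = (b - a) / (a - 1)"
          using \<beta> a by (simp_all add: \<theta> k_def field_simps)
        then show ?thesis using a \<beta> by (simp add: \<theta>)
      qed
      have "(1 - t) * (k - 1) \<le> (1 - \<theta>) * (k - 1)"
        using \<open>\<theta> \<le> t\<close> k1 by (intro mult_right_mono) auto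
      also have "\<dots> \<le> b * t"
        unfolding \<theta>k using \<open>\<theta> \<le> t\<close> a \<beta> by (intro mult_left_mono) auto
      finally have tk: "(1 - t) * (k - 1) \<le> b * t" .
      have te: "(1 - t) * (k - 1) * (1 - \<epsilon> / t) = b * (t - \<epsilon>)"
      proof (cases "t = \<epsilon>")
        case False
        then have "t = \<theta>" using t by simp
        then show ?thesis using \<theta>k tp by (simp add: field_simps)
      qed (use tp in simp)
      have "R = (\<Sum>x<d. min (p $ x) (\<gamma> * q $ x) powr b * (q $ x) powr (1 - b))"
        by (simp add: R_def r(2))
      also have "\<dots> \<le> (1 - t) powr b * (\<epsilon> / t) powr (1 - k) * Q powr k"
        unfolding Q_def using p' q' pq \<gamma> a \<beta> \<epsilon> t tk te
        by (intro truncated_renyi_sum_le) (auto simp: k_def)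
      finally have RQ: "R \<le> (1 - t) powr b * (\<epsilon> / t) powr (1 - k) * Q powr k" .
      have R: "0 < R"
        unfolding R_def using r r0 q' rq rne by (intro renyi_sum_pos) auto
      have "log 2 R \<le> log 2 ((1 - t) powr b * (\<epsilon> / t) powr (1 - k) * Q powr k)"
        using R RQ by (intro log_mono) auto
      also have "\<dots> = b * log 2 (1 - t) + (1 - k) * log 2 (\<epsilon> / t) + k * log 2 Q"
        using \<epsilon> t Q by (simp add: log_mult log_powr Q_def)
      finally have "1 / (b - 1) * log 2 R
          \<le> 1 / (b - 1) * (b * log 2 (1 - t) + (1 - k) * log 2 (\<epsilon> / t) + k * log 2 Q)"
        using a \<beta> by (intro mult_left_mono) auto
      also have "\<dots> = c * log 2 (1 - t) + ((1 - k) / (b - 1)) * log 2 (\<epsilon> / t) + (k / (b - 1)) * log 2 Q"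
        by (simp add: c algebra_simps add_divide_distrib diff_divide_distrib)
      also have "k / (b - 1) = 1 / (a - 1)"
        using a \<beta> by (simp add: k_def)
      also have "(1 - k) / (b - 1) = c - a / (a - 1)"
        using a \<beta> by (simp add: k_def c field_simps)
      finally show ?thesis
        using \<beta> a rq rne r unfolding Da by (simp add: renyi_div_def R_def)
    next
      assume \<beta>: "\<beta> = \<infinity>" and \<theta>: "\<theta> = 1 / a" and c: "c = 1"
      have "1 \<le> t * a" using \<open>\<theta> \<le> t\<close> a by (simp add: \<theta> field_simps)
      then have tk: "1 - t \<le> t * (a - 1)" by (simp add: algebra_simps)
      have te: "(1 - t) / (a - 1) * (1 - \<epsilon> / t) = t - \<epsilon>"
      proof (cases "t = \<epsilon>")
        case False
        then have "t = 1 / a" using t \<theta> by simp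
        moreover from this have "(1 - t) / (a - 1) = t" using a by (simp add: field_simps)
        ultimately show ?thesis using tp by (simp add: right_diff_distrib)
      qed (use tp in simp)
      have "\<epsilon> / t \<le> ((1 - t) / \<gamma>) powr (a - 1) * Q"
        unfolding Q_def using p' q' pq \<gamma> a \<epsilon> t tk te
        by (intro truncation_level_bound) auto
      then have "log 2 (\<epsilon> / t) \<le> log 2 (((1 - t) / \<gamma>) powr (a - 1) * Q)"
        using \<epsilon> tp by (intro log_mono) auto
      also have "\<dots> = (a - 1) * (log 2 (1 - t) - log 2 \<gamma>) + log 2 Q"
        using t \<gamma> Q by (simp add: log_mult log_powr log_divide Q_def)
      finally have "1 / (a - 1) * log 2 (\<epsilon> / t)
          \<le> 1 / (a - 1) * ((a - 1) * (log 2 (1 - t) - log 2 \<gamma>) + log 2 Q)"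
        using a by (intro mult_left_mono) auto
      also have "\<dots> = log 2 (1 - t) - log 2 \<gamma> + 1 / (a - 1) * log 2 Q"
        using a by (simp add: add_divide_distrib)
      finally have *: "log 2 \<gamma> \<le> 1 / (a - 1) * log 2 Q + (log 2 (1 - t) - 1 / (a - 1) * log 2 (\<epsilon> / t))"
        by simp
      have cc: "c - a / (a - 1) = - (1 / (a - 1))" using a by (simp add: c field_simps)
      let ?M = "Max ((\<lambda>x. r $ x / q $ x) ` supp_vec r)"
      have fin: "finite (supp_vec r)" by (simp add: supp_vec_def)
      have pos: "0 < r $ x \<and> 0 < q $ x" if "x \<in> supp_vec r" for x
        using that rq r0[of x] q'(2)[of x] r(1) q'(1) by (auto simp: supp_vec_def less_le)
      have "?M \<le> \<gamma>"
      proof (subst Max_le_iff)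
        show "\<forall>y\<in>(\<lambda>x. r $ x / q $ x) ` supp_vec r. y \<le> \<gamma>"
        proof safe
          fix x assume x: "x \<in> supp_vec r"
          then have "r $ x \<le> \<gamma> * q $ x" using r by (auto simp: supp_vec_def)
          then show "r $ x / q $ x \<le> \<gamma>" using pos[OF x] by (simp add: divide_le_eq)
        qed
      qed (use fin rne in auto)
      moreover have "0 < ?M"
        using fin rne pos by (subst Max_gr_iff) auto
      ultimately have "log 2 ?M \<le> log 2 \<gamma>"
        by (intro log_mono) auto
      then have "log 2 ?M \<le> 1 / (a - 1) * log 2 Q + (c * log 2 (1 - t) + (c - a / (a - 1)) * log 2 (\<epsilon> / t))"
        using * unfolding cc unfolding c by simp
      then show ?thesis
        using \<beta> rq rne unfolding Da by (simp add: renyi_div_def)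
    qed
  qed
qed

lemma prob_vec_two: "0 \<le> x \<Longrightarrow> x \<le> 1 \<Longrightarrow> vec 2 (\<lambda>i. if i = 0 then 1 - x else x) \<in> prob_vec 2"
  by (auto simp: prob_vec_def numeral_2_eq_2)

lemma le_smoothed_renyi_div:
  assumes "\<And>r. r \<in> subprob_vec (dim_vec p) \<Longrightarrow> (\<Sum>x<dim_vec p. max (p $ x - r $ x) 0) \<le> \<epsilon>
    \<Longrightarrow> u \<le> renyi_div \<beta> r q"
  shows "u \<le> smoothed_renyi_div \<epsilon> \<beta> p q"
  unfolding smoothed_renyi_div_def using assms by (intro INF_greatest) auto

text \<open>A loss of at most \<open>\<epsilon>\<close> leaves at least
  \<open>w - \<epsilon>\<close> in the second coordinate, and that coordinate alone bounds the
  smoothed divergence. As \<open>\<delta>\<close> tends to 0 the bound and the divergence of order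
  \<open>a\<close> contain the same term \<open>- log 2 \<delta>\<close>, which cancels.\<close>

lemma mu_sub_gt_1_ge:
  assumes ext: "quantum_extension (renyi_div (ereal a)) D"
    and \<epsilon>: "0 < \<epsilon>" and a: "1 < a" and w: "\<epsilon> < w" "w \<le> 1"
    and \<beta>: "\<beta> = ereal b \<and> a < b \<and> c = b / (b - 1) \<or> \<beta> = \<infinity> \<and> c = 1"
  shows "ereal (c * log 2 (w - \<epsilon>) - a / (a - 1) * log 2 w) \<le> mu_sub \<epsilon> \<beta> D"
proof -
  \<comment> \<open>The \<open>\<alpha>\<close>-sum multiplied by
    \<open>\<delta> powr (a - 1)\<close>, which makes it converge to
    \<open>w powr a\<close>.\<close>
  define F where "F \<delta> = (1 - w) powr a * (1 - \<delta>) powr (1 - a) * \<delta> powr (a - 1) + w powr a" for \<delta> :: real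
  define y where "y \<delta> = c * log 2 (w - \<epsilon>) - 1 / (a - 1) * log 2 (F \<delta>)" for \<delta>
  have w0: "0 < w" using \<epsilon> w by simp
  have bound: "ereal (y \<delta>) \<le> mu_sub \<epsilon> \<beta> D" if \<delta>: "0 < \<delta>" "\<delta> < 1" for \<delta>
  proof (rule le_mu_subI[OF ext])
    let ?p = "vec 2 (\<lambda>i. if i = 0 then 1 - w else w)" and ?q = "vec 2 (\<lambda>i. if i = 0 then 1 - \<delta> else \<delta>)"
    show "?p \<in> prob_vec 2" "?q \<in> prob_vec 2"
      using w0 w \<delta> by (auto intro!: prob_vec_two)
    have q: "supp_vec ?q = {0, 1}" using \<delta> by (auto simp: supp_vec_def less_2_cases_iff)
    have p: "supp_vec ?p \<subseteq> {0, 1}" "supp_vec ?p \<noteq> {}"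
      using w0 by (auto simp: supp_vec_def less_2_cases_iff)
    define Q where "Q = (1 - w) powr a * (1 - \<delta>) powr (1 - a) + w powr a * \<delta> powr (1 - a)"
    have Q: "0 < Q" using w0 \<delta> by (auto simp: Q_def intro!: add_nonneg_pos)
    show "renyi_div (ereal a) ?p ?q = ereal (1 / (a - 1) * log 2 Q)"
      using p q a by (simp add: renyi_div_def Q_def numeral_2_eq_2)
    have "F \<delta> = \<delta> powr (a - 1) * Q"
      using \<delta> by (simp add: F_def Q_def powr_diff field_simps)
    then have "log 2 (F \<delta>) = (a - 1) * log 2 \<delta> + log 2 Q"
      using Q \<delta> by (simp add: log_mult log_powr)
    then have "1 / (a - 1) * log 2 (F \<delta>) = log 2 \<delta> + 1 / (a - 1) * log 2 Q"
      using a by (simp add: add_divide_distrib)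
    then have y: "1 / (a - 1) * log 2 Q + y \<delta> = c * log 2 (w - \<epsilon>) - log 2 \<delta>"
      by (simp add: y_def)
    show "ereal (1 / (a - 1) * log 2 Q + y \<delta>) \<le> smoothed_renyi_div \<epsilon> \<beta> ?p ?q"
      unfolding y
    proof (rule le_smoothed_renyi_div)
      fix r assume "r \<in> subprob_vec (dim_vec ?p)" and loss: "(\<Sum>x<dim_vec ?p. max (?p $ x - r $ x) 0) \<le> \<epsilon>"
      then have r: "dim_vec r = 2" "0 \<le> r $ 0" "0 \<le> r $ 1"
        by (auto simp: subprob_vec_def)
      have r1: "w - \<epsilon> \<le> r $ 1"
        using loss by (simp add: numeral_2_eq_2)
      have supp: "supp_vec r \<subseteq> {0, 1}" "1 \<in> supp_vec r"
        using r r1 w by (auto simp: supp_vec_def less_2_cases_iff)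
      show "ereal (c * log 2 (w - \<epsilon>) - log 2 \<delta>) \<le> renyi_div \<beta> r ?q"
        using \<beta>
      proof (elim disjE conjE)
        assume \<beta>: "\<beta> = ereal b" "a < b" and c: "c = b / (b - 1)"
        have "b * log 2 (w - \<epsilon>) + (1 - b) * log 2 \<delta> = log 2 ((w - \<epsilon>) powr b * \<delta> powr (1 - b))"
          using w \<delta> by (simp add: log_mult log_powr)
        also have "\<dots> \<le> log 2 ((r $ 0) powr b * (1 - \<delta>) powr (1 - b) + (r $ 1) powr b * \<delta> powr (1 - b))"
        proof (intro log_mono)
          have "(w - \<epsilon>) powr b * \<delta> powr (1 - b) \<le> (r $ 1) powr b * \<delta> powr (1 - b)"
            using r1 w a \<beta> by (intro mult_right_mono powr_mono2) auto
          then show "(w - \<epsilon>) powr b * \<delta> powr (1 - b)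
              \<le> (r $ 0) powr b * (1 - \<delta>) powr (1 - b) + (r $ 1) powr b * \<delta> powr (1 - b)"
            by (simp add: add_increasing)
        qed (use w \<delta> in auto)
        finally have "1 / (b - 1) * (b * log 2 (w - \<epsilon>) + (1 - b) * log 2 \<delta>)
            \<le> 1 / (b - 1) * log 2 ((r $ 0) powr b * (1 - \<delta>) powr (1 - b) + (r $ 1) powr b * \<delta> powr (1 - b))"
          using a \<beta> by (intro mult_left_mono) auto
        moreover have "1 / (b - 1) * (b * log 2 (w - \<epsilon>) + (1 - b) * log 2 \<delta>) = c * log 2 (w - \<epsilon>) - log 2 \<delta>"
          using a \<beta> by (simp add: c field_simps)
        ultimately show ?thesis
          using \<beta> a q supp r by (auto simp: renyi_div_def numeral_2_eq_2)
      next
        assume \<beta>: "\<beta> = \<infinity>" and c: "c = 1"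
        have fin: "finite (supp_vec r)" by (simp add: supp_vec_def)
        have "(w - \<epsilon>) / \<delta> \<le> r $ 1 / ?q $ 1"
          using r1 \<delta> by (simp add: divide_right_mono)
        also have "\<dots> \<le> Max ((\<lambda>x. r $ x / ?q $ x) ` supp_vec r)"
          by (rule Max_ge[OF finite_imageI[OF fin] imageI[OF supp(2)]])
        finally have "log 2 ((w - \<epsilon>) / \<delta>) \<le> log 2 (Max ((\<lambda>x. r $ x / ?q $ x) ` supp_vec r))"
          using w \<delta> by (intro log_mono) auto
        then show ?thesis
          using \<beta> c q supp w \<delta> by (auto simp: renyi_div_def log_divide)
      qed
    qed
  qed
  have nonneg: "\<forall>\<^sub>F \<delta> in at_right (0::real). 0 \<le> \<delta>"
    using eventually_at_right_less[of 0] by (rule eventually_mono) simp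
  have "((\<lambda>\<delta>. y \<delta>) \<longlongrightarrow> c * log 2 (w - \<epsilon>) - 1 / (a - 1) * log 2 ((1 - w) powr a * (1 - 0) powr (1 - a) * 0 powr (a - 1) + w powr a))
      (at_right 0)"
    unfolding y_def F_def using a w0
    by (intro tendsto_intros tendsto_powr') (auto simp: nonneg)
  moreover have "log 2 (w powr a) = a * log 2 w"
    using w0 by (simp add: log_powr)
  ultimately have lim: "((\<lambda>\<delta>. y \<delta>) \<longlongrightarrow> c * log 2 (w - \<epsilon>) - a / (a - 1) * log 2 w) (at_right 0)"
    by simp
  have "\<forall>\<^sub>F \<delta> in at_right 0. ereal (y \<delta>) \<le> mu_sub \<epsilon> \<beta> D"
    using bound by (auto simp: eventually_at_right_field intro!: exI[of _ 1])
  then show ?thesis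
    using lim by (intro tendsto_upperbound[OF tendsto_ereal]) auto
qed

lemma mu_sub_gt_1:
  assumes ext: "quantum_extension (renyi_div (ereal a)) D"
    and \<epsilon>: "0 < \<epsilon>" "\<epsilon> < 1" and a: "1 < a"
    and \<beta>: "\<beta> = ereal b \<and> a < b \<and> \<theta> = (b - a) / (a * (b - 1)) \<and> c = b / (b - 1)
      \<or> \<beta> = \<infinity> \<and> \<theta> = 1 / a \<and> c = 1"
  shows "mu_sub \<epsilon> \<beta> D =
    ereal (if \<epsilon> \<le> \<theta> then a / (a - 1) * (\<theta> * log 2 (1 / \<epsilon>) - h2 \<theta>) else c * log 2 (1 - \<epsilon>))"
proof -
  have c: "c = a / (a - 1) * (1 - \<theta>)" and \<theta>: "0 < \<theta>" "\<theta> < 1"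
    using \<beta>
  proof (atomize (full), elim disjE conjE)
    assume b: "a < b" "\<theta> = (b - a) / (a * (b - 1))" "c = b / (b - 1)"
    have th: "1 - \<theta> = b * (a - 1) / (a * (b - 1))"
      using a b(1) by (simp add: b(2) field_simps)
    have "0 < 1 - \<theta>" unfolding th using a b(1) by simp
    moreover have "0 < \<theta>" using a b(1) by (simp add: b(2))
    moreover have "c = a / (a - 1) * (1 - \<theta>)" unfolding th b(3) using a b(1) by simp
    ultimately show "c = a / (a - 1) * (1 - \<theta>) \<and> 0 < \<theta> \<and> \<theta> < 1" by simp
  next
    assume "\<theta> = 1 / a" "c = 1"
    moreover from this have "1 - \<theta> = (a - 1) / a" using a by (simp add: field_simps)
    ultimately show "c = a / (a - 1) * (1 - \<theta>) \<and> 0 < \<theta> \<and> \<theta> < 1"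
      using a by simp
  qed
  define t where "t = max \<epsilon> \<theta>"
  define \<mu> where "\<mu> = c * log 2 (1 - t) + (c - a / (a - 1)) * log 2 (\<epsilon> / t)"
  have t: "\<epsilon> \<le> t" "t < 1" "t = \<epsilon> \<or> t = \<theta>" "\<theta> \<le> t" "0 < t"
    using \<epsilon> \<theta> by (auto simp: t_def max_def)
  have "mu_sub \<epsilon> \<beta> D \<le> ereal \<mu>"
    unfolding \<mu>_def
    by (rule mu_sub_leI[OF ext]) (rule smoothed_le_renyi_div_add_gt_1[OF _ _ \<epsilon> a t(1-3) \<beta> t(4)])
  moreover have "ereal \<mu> \<le> mu_sub \<epsilon> \<beta> D"
  proof -
    \<comment> \<open>The maximiser \<open>\<epsilon> / \<theta>\<close> of the lower bound, capped
      at 1.\<close>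
    define w where "w = \<epsilon> / t"
    have w: "\<epsilon> < w" "w \<le> 1" and w\<epsilon>: "w - \<epsilon> = w * (1 - t)"
      using t \<epsilon> by (auto simp: w_def field_simps)
    have "ereal (c * log 2 (w - \<epsilon>) - a / (a - 1) * log 2 w) \<le> mu_sub \<epsilon> \<beta> D"
      using \<beta> by (intro mu_sub_gt_1_ge[OF ext \<epsilon>(1) a w]) auto
    moreover have "log 2 (w - \<epsilon>) = log 2 w + log 2 (1 - t)"
      unfolding w\<epsilon> using w \<epsilon> t by (simp add: log_mult)
    then have "c * log 2 (w - \<epsilon>) - a / (a - 1) * log 2 w = \<mu>"
      by (simp add: \<mu>_def algebra_simps flip: w_def)
    ultimately show ?thesis by simp
  qed
  moreover have "\<mu> = (if \<epsilon> \<le> \<theta> then a / (a - 1) * (\<theta> * log 2 (1 / \<epsilon>) - h2 \<theta>) else c * log 2 (1 - \<epsilon>))"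
  proof (cases "\<epsilon> \<le> \<theta>")
    case True
    then have "t = \<theta>" by (simp add: t_def)
    moreover have "c - a / (a - 1) = a / (a - 1) * (- \<theta>)" by (simp add: c right_diff_distrib)
    ultimately have "\<mu> = a / (a - 1) * ((1 - \<theta>) * log 2 (1 - \<theta>) - \<theta> * log 2 (\<epsilon> / \<theta>))"
      by (simp add: \<mu>_def c right_diff_distrib del: times_divide_eq_left times_divide_eq_right)
    also have "(1 - \<theta>) * log 2 (1 - \<theta>) - \<theta> * log 2 (\<epsilon> / \<theta>) = \<theta> * log 2 (1 / \<epsilon>) - h2 \<theta>"
      using \<epsilon> \<theta> by (simp add: h2_def log_divide algebra_simps)
    finally show ?thesis using True by simp
  qed (use \<epsilon> in \<open>simp add: \<mu>_def t_def\<close>)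
  ultimately show ?thesis by simp
qed

section \<open>Orders below 1\<close>

lemma smoothed_le_renyi_div_add_lt_1:
  assumes p: "p \<in> prob_vec d" and q: "q \<in> prob_vec d"
    and \<epsilon>: "0 < \<epsilon>" and ab: "0 < a" "a < b" "b < 1"
    and \<theta>: "\<theta> = (b - a) / (b * (1 - a))"
  shows "smoothed_renyi_div \<epsilon> (ereal b) p q
    \<le> renyi_div (ereal a) p q + ereal (max 0 (b / (1 - b) * (\<theta> * log 2 (1 / \<epsilon>) - h2 \<theta>)))"
proof (cases "supp_vec p \<inter> supp_vec q = {}")
  case True
  then show ?thesis using ab by (simp add: renyi_div_def)
next
  case False
  have p': "p \<in> carrier_vec d" "\<And>x. x < d \<Longrightarrow> 0 \<le> p $ x" "(\<Sum>x<d. p $ x) = 1"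
    and q': "q \<in> carrier_vec d" "\<And>x. x < d \<Longrightarrow> 0 \<le> q $ x" "(\<Sum>x<d. q $ x) = 1"
    using p q by (auto simp: prob_vec_def)
  define Q where "Q = (\<Sum>x<d. (p $ x) powr a * (q $ x) powr (1 - a))"
  have Q: "0 < Q"
    unfolding Q_def using False p' q' by (intro renyi_sum_pos) auto
  define k where "k = (1 - b) / (1 - a)"
  define W where "W = (\<epsilon> / \<theta>) powr (b * \<theta>) * (1 - \<theta>) powr (- (a * k))"
  have th: "1 - \<theta> = a * (1 - b) / (b * (1 - a))"
    using ab by (simp add: \<theta> field_simps)
  then have \<theta>01: "0 < \<theta>" "0 < 1 - \<theta>" using ab by (simp_all add: \<theta>)
  have ak: "a * k = b * (1 - \<theta>)" using ab by (simp add: th k_def)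
  have W0: "0 < W" using \<theta>01 \<epsilon> by (simp add: W_def)
  obtain f where f: "\<And>x. x < d \<Longrightarrow> 0 \<le> f x" "sum f {..<d} = 1" "(\<Sum>x<d. max (p $ x - f x) 0) \<le> \<epsilon>"
    "min 1 W * Q powr k \<le> (\<Sum>x<d. f x powr b * (q $ x) powr (1 - b))"
  proof (rule filled_renyi_sum_ge[of "{..<d}" "($) p" "($) q" \<epsilon> a b k \<theta> "min 1 W"])
    show "min 1 W \<le> (\<epsilon> / \<theta>) powr (b * \<theta>) * (1 - \<theta>) powr (- (a * k))"
      unfolding W_def by (rule min.cobounded2)
  qed (use p' q' \<epsilon> ab \<theta> that in \<open>auto simp: k_def Q_def\<close>)
  define r where "r = vec d f"
  define R where "R = (\<Sum>x<d. (r $ x) powr b * (q $ x) powr (1 - b))"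
  have r: "r \<in> carrier_vec d" "\<And>x. x < d \<Longrightarrow> r $ x = f x" by (auto simp: r_def)
  have RQ: "min 1 W * Q powr k \<le> R"
    using f(4) by (simp add: R_def r(2))
  have WQ: "0 < min 1 W * Q powr k" using W0 Q by simp
  \<comment> \<open>The factor 1 comes from the case \<open>r = q\<close> and from the part of
    \<open>q\<close> proportional to \<open>r\<close>; dividing by \<open>b - 1 < 0\<close> turns
    the minimum into the maximum with 0.\<close>
  have logW: "log 2 (min 1 W) / (b - 1) = max 0 (b / (1 - b) * (\<theta> * log 2 (1 / \<epsilon>) - h2 \<theta>))"
  proof -
    have "log 2 W = b * \<theta> * (log 2 \<epsilon> - log 2 \<theta>) - b * (1 - \<theta>) * log 2 (1 - \<theta>)"
      using \<theta>01 \<epsilon> by (simp add: W_def ak log_mult log_powr log_divide)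
    also have "\<dots> = - (b * (\<theta> * log 2 (1 / \<epsilon>) - h2 \<theta>))"
      using \<epsilon> by (simp add: h2_def log_divide algebra_simps)
    finally have "log 2 W / (b - 1) = - (b * (\<theta> * log 2 (1 / \<epsilon>) - h2 \<theta>)) / - (1 - b)"
      by simp
    then have W: "log 2 W / (b - 1) = b / (1 - b) * (\<theta> * log 2 (1 / \<epsilon>) - h2 \<theta>)"
      by (simp only: minus_divide_divide times_divide_eq_left)
    show ?thesis
    proof (cases "W \<le> 1")
      case True
      then have "log 2 W / (b - 1) \<ge> 0"
        using W0 ab by (simp add: divide_nonpos_neg)
      then show ?thesis using True unfolding W[symmetric] by (simp add: min_def)
    next
      case False
      then have "log 2 W / (b - 1) \<le> 0"
        using W0 ab by (simp add: divide_nonneg_neg)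
      then show ?thesis using False unfolding W[symmetric] by (simp add: min_def)
    qed
  qed
  show ?thesis
  proof (rule smoothed_renyi_div_le)
    show "r \<in> subprob_vec (dim_vec p)"
      using p' r f by (simp add: subprob_vec_def)
    show "(\<Sum>x<dim_vec p. max (p $ x - r $ x) 0) \<le> \<epsilon>"
      using p' f(3) by (simp add: r(2))
    have "0 < R" using RQ WQ by simp
    have meet: "supp_vec r \<inter> supp_vec q \<noteq> {}"
    proof
      assume disjoint: "supp_vec r \<inter> supp_vec q = {}"
      have "r $ x = 0 \<or> q $ x = 0" if "x < d" for x
        using that disjoint r(1) q'(1) by (auto simp: supp_vec_def)
      then have "R = 0" unfolding R_def by (intro sum.neutral) auto
      then show False using \<open>0 < R\<close> by simp
    qed
    have "log 2 (min 1 W) + k * log 2 Q = log 2 (min 1 W * Q powr k)"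
      using W0 Q by (simp add: log_mult log_powr)
    also have "\<dots> \<le> log 2 R"
      using RQ WQ by (intro log_mono) auto
    finally have "1 / (b - 1) * log 2 R \<le> 1 / (b - 1) * (log 2 (min 1 W) + k * log 2 Q)"
      using ab by (intro mult_left_mono_neg) auto
    also have "\<dots> = k / (b - 1) * log 2 Q + log 2 (min 1 W) / (b - 1)"
      by (simp add: add_divide_distrib)
    also have "k / (b - 1) = 1 / (a - 1)"
      using minus_divide_divide[of "b - 1" "a - 1"] ab by (simp add: k_def)
    finally show "renyi_div (ereal b) r q
      \<le> renyi_div (ereal a) p q + ereal (max 0 (b / (1 - b) * (\<theta> * log 2 (1 / \<epsilon>) - h2 \<theta>)))"
      unfolding logW using ab False meet p' r by (simp add: renyi_div_def Q_def R_def del: ereal_max)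
  qed
qed

text \<open>The first coordinate of \<open>r\<close> is at least \<open>1 - x - \<epsilon>\<close>,
  so total mass at most 1 forces \<open>r $ 1 \<le> x + \<epsilon>\<close>; below order 1 the
  divergence from a point mass decreases in that coordinate.\<close>

lemma mu_sub_lt_1_ge:
  assumes ext: "quantum_extension (renyi_div (ereal a)) D"
    and \<epsilon>: "0 \<le> \<epsilon>" and ab: "0 < a" "a < b" "b < 1" and x: "0 < x" "x \<le> 1"
  shows "ereal (a / (1 - a) * log 2 x - b / (1 - b) * log 2 (min 1 (x + \<epsilon>))) \<le> mu_sub \<epsilon> (ereal b) D"
proof (rule le_mu_subI[OF ext])
  \<comment> \<open>\<open>1 - 1\<close> instead of 0 makes the point mass an instance of
    \<open>prob_vec_two\<close>.\<close>
  let ?p = "vec 2 (\<lambda>i. if i = 0 then 1 - x else x)" and ?q = "vec 2 (\<lambda>i. if i = 0 then 1 - 1 else 1 :: real)"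
  show "?p \<in> prob_vec 2" "?q \<in> prob_vec 2"
    using x by (auto intro!: prob_vec_two)
  have q: "supp_vec ?q = {1}" by (auto simp: supp_vec_def less_2_cases_iff)
  have p: "1 \<in> supp_vec ?p" using x by (auto simp: supp_vec_def)
  show "renyi_div (ereal a) ?p ?q = ereal (1 / (a - 1) * (a * log 2 x))"
    using p q ab x by (auto simp: renyi_div_def numeral_2_eq_2 log_powr)
  have minus: "1 / (z - 1) * (z * X) = - (z / (1 - z) * X)" for z X :: real
  proof -
    have "1 / (z - 1) = - (1 / (1 - z))" by (metis minus_diff_eq divide_minus_right)
    then show ?thesis by simp
  qed
  have "1 / (a - 1) * (a * log 2 x) + (a / (1 - a) * log 2 x - b / (1 - b) * log 2 (min 1 (x + \<epsilon>)))
      = 1 / (b - 1) * (b * log 2 (min 1 (x + \<epsilon>)))"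
    unfolding minus by simp
  moreover have "ereal (1 / (b - 1) * (b * log 2 (min 1 (x + \<epsilon>)))) \<le> smoothed_renyi_div \<epsilon> (ereal b) ?p ?q"
  proof (rule le_smoothed_renyi_div)
    fix r assume "r \<in> subprob_vec (dim_vec ?p)" and loss: "(\<Sum>x<dim_vec ?p. max (?p $ x - r $ x) 0) \<le> \<epsilon>"
    then have r: "dim_vec r = 2" "0 \<le> r $ 0" "0 \<le> r $ 1" "r $ 0 + r $ 1 \<le> 1"
      by (auto simp: subprob_vec_def numeral_2_eq_2)
    have r1: "r $ 1 \<le> min 1 (x + \<epsilon>)"
      using loss r by (simp add: numeral_2_eq_2)
    show "ereal (1 / (b - 1) * (b * log 2 (min 1 (x + \<epsilon>)))) \<le> renyi_div (ereal b) r ?q"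
    proof (cases "r $ 1 = 0")
      case True
      then have "supp_vec r \<inter> supp_vec ?q = {}"
        unfolding q by (simp add: supp_vec_def)
      then show ?thesis using ab by (simp add: renyi_div_def)
    next
      case False
      then have "log 2 (r $ 1) \<le> log 2 (min 1 (x + \<epsilon>))"
        using r r1 by (intro log_mono) auto
      then have "1 / (b - 1) * (b * log 2 (min 1 (x + \<epsilon>))) \<le> 1 / (b - 1) * (b * log 2 (r $ 1))"
        using ab by (intro mult_left_mono_neg mult_left_mono) auto
      moreover have "1 \<in> supp_vec r" using False r by (simp add: supp_vec_def)
      ultimately show ?thesis
        using ab q r False by (auto simp: renyi_div_def numeral_2_eq_2 log_powr)
    qed
  qed
  ultimately show "ereal (1 / (a - 1) * (a * log 2 x)
      + (a / (1 - a) * log 2 x - b / (1 - b) * log 2 (min 1 (x + \<epsilon>)))) \<le> smoothed_renyi_div \<epsilon> (ereal b) ?p ?q"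
    by simp
qed

lemma mu_sub_lt_1:
  assumes ext: "quantum_extension (renyi_div (ereal a)) D"
    and \<epsilon>: "0 < \<epsilon>" and ab: "0 < a" "a < b" "b < 1"
    and \<theta>: "\<theta> = (b - a) / (b * (1 - a))"
  shows "mu_sub \<epsilon> (ereal b) D = ereal (max 0 (b / (1 - b) * (\<theta> * log 2 (1 / \<epsilon>) - h2 \<theta>)))"
proof (rule antisym)
  show "mu_sub \<epsilon> (ereal b) D \<le> ereal (max 0 (b / (1 - b) * (\<theta> * log 2 (1 / \<epsilon>) - h2 \<theta>)))"
    by (intro mu_sub_leI[OF ext] smoothed_le_renyi_div_add_lt_1 \<epsilon> ab \<theta>)
  have th: "1 - \<theta> = a * (1 - b) / (b * (1 - a))"
    using ab by (simp add: \<theta> field_simps)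
  then have \<theta>01: "0 < \<theta>" "0 < 1 - \<theta>" using ab by (simp_all add: \<theta>)
  have zero: "ereal 0 \<le> mu_sub \<epsilon> (ereal b) D"
    using mu_sub_lt_1_ge[OF ext _ ab, of \<epsilon> 1] \<epsilon> by simp
  show "ereal (max 0 (b / (1 - b) * (\<theta> * log 2 (1 / \<epsilon>) - h2 \<theta>))) \<le> mu_sub \<epsilon> (ereal b) D"
  proof (cases "\<epsilon> \<le> \<theta>")
    case True
    \<comment> \<open>The stationary point of the lower bound in \<open>x\<close>; it gives
      \<open>x + \<epsilon> = \<epsilon> / \<theta>\<close>, which is at most 1 because
      \<open>\<epsilon> \<le> \<theta>\<close>.\<close>
    define x where "x = \<epsilon> * (1 - \<theta>) / \<theta>"
    have x: "0 < x" "x + \<epsilon> = \<epsilon> / \<theta>" using \<epsilon> \<theta>01 by (auto simp: x_def field_simps)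
    have "\<epsilon> / \<theta> \<le> 1" using True \<theta>01 by simp
    then have x1: "x \<le> 1" and min1: "min 1 (x + \<epsilon>) = \<epsilon> / \<theta>" using x \<epsilon> by auto
    have "ereal (a / (1 - a) * log 2 x - b / (1 - b) * log 2 (\<epsilon> / \<theta>)) \<le> mu_sub \<epsilon> (ereal b) D"
      unfolding min1[symmetric] using \<epsilon> by (intro mu_sub_lt_1_ge[OF ext _ ab x(1) x1]) simp
    moreover have "a / (1 - a) = b / (1 - b) * (1 - \<theta>)"
      using ab by (simp add: th)
    moreover have "(1 - \<theta>) * log 2 x - log 2 (\<epsilon> / \<theta>) = \<theta> * log 2 (1 / \<epsilon>) - h2 \<theta>"
    proof -
      have logx: "log 2 x = log 2 \<epsilon> + log 2 (1 - \<theta>) - log 2 \<theta>"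
        using \<epsilon> \<theta>01 by (simp add: x_def log_mult log_divide)
      show ?thesis
        unfolding logx using \<epsilon> \<theta>01 by (simp add: h2_def log_divide algebra_simps)
    qed
    ultimately have "ereal (b / (1 - b) * (\<theta> * log 2 (1 / \<epsilon>) - h2 \<theta>)) \<le> mu_sub \<epsilon> (ereal b) D"
      by (metis mult.assoc right_diff_distrib)
    then show ?thesis using zero by (simp add: max_def)
  next
    case False
    \<comment> \<open>In this form both summands are nonpositive for
      \<open>\<theta> < \<epsilon>\<close>, so the maximum is 0, which \<open>x = 1\<close>
      attains.\<close>
    have "\<theta> * log 2 (1 / \<epsilon>) - h2 \<theta> = \<theta> * (log 2 \<theta> - log 2 \<epsilon>) + (1 - \<theta>) * log 2 (1 - \<theta>)"
      using \<epsilon> by (simp add: h2_def log_divide algebra_simps)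
    also have "\<dots> \<le> 0"
      using False \<theta>01 \<epsilon> by (intro add_nonpos_nonpos mult_nonneg_nonpos) (auto simp: log_le_zero_cancel_iff)
    finally have "b / (1 - b) * (\<theta> * log 2 (1 / \<epsilon>) - h2 \<theta>) \<le> 0"
      using ab by (intro mult_nonneg_nonpos) auto
    then show ?thesis using zero by (simp only: max_absorb1)
  qed
qed

theorem theorem5:
  fixes \<epsilon> :: real and \<alpha> \<beta> :: ereal
    and D :: "complex mat \<Rightarrow> complex mat \<Rightarrow> ereal"
  assumes "0 < \<epsilon>" and "\<epsilon> < 1"
    and "0 \<le> \<alpha>" and "0 \<le> \<beta>"
    and "quantum_extension (renyi_div \<alpha>) D"
  shows "(1 < \<alpha> \<and> \<alpha> < \<beta> \<longrightarrow>
      (let a = real_of_ereal \<alpha>;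
           b = real_of_ereal \<beta>;
           \<theta> = (if \<beta> = \<infinity> then 1 / a else (b - a) / (a * (b - 1)));
           c = (if \<beta> = \<infinity> then 1 else b / (b - 1))
       in mu_sub \<epsilon> \<beta> D =
          ereal (if \<epsilon> \<le> \<theta> then a / (a - 1) * (\<theta> * log 2 (1 / \<epsilon>) - h2 \<theta>)
                 else c * log 2 (1 - \<epsilon>)))) \<and>
    (0 < \<alpha> \<and> \<alpha> < \<beta> \<and> \<beta> < 1 \<longrightarrow>
      (let a = real_of_ereal \<alpha>;
           b = real_of_ereal \<beta>;
           \<theta> = (b - a) / (b * (1 - a))
       in mu_sub \<epsilon> \<beta> D =
          ereal (max 0 (b / (1 - b) * (\<theta> * log 2 (1 / \<epsilon>) - h2 \<theta>)))))"
proof (intro conjI impI)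
  assume "1 < \<alpha> \<and> \<alpha> < \<beta>"
  moreover from this obtain a where a: "\<alpha> = ereal a" by (cases \<alpha>) auto
  ultimately have "1 < a" "\<alpha> < \<beta>" by auto
  \<comment> \<open>Only \<open>\<beta>\<close> can be infinite; then
    \<open>real_of_ereal \<beta>\<close> is 0 and the second alternative for \<open>\<beta>\<close>
    in \<open>mu_sub_gt_1\<close> is the one that holds.\<close>
  then show "let a = real_of_ereal \<alpha>;
           b = real_of_ereal \<beta>;
           \<theta> = (if \<beta> = \<infinity> then 1 / a else (b - a) / (a * (b - 1)));
           c = (if \<beta> = \<infinity> then 1 else b / (b - 1))
       in mu_sub \<epsilon> \<beta> D =
          ereal (if \<epsilon> \<le> \<theta> then a / (a - 1) * (\<theta> * log 2 (1 / \<epsilon>) - h2 \<theta>)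
                 else c * log 2 (1 - \<epsilon>))"
    using assms unfolding Let_def a
    by (intro mu_sub_gt_1[where b = "real_of_ereal \<beta>"]) (cases \<beta>; auto)+
next
  assume "0 < \<alpha> \<and> \<alpha> < \<beta> \<and> \<beta> < 1"
  moreover from this obtain a b where ab: "\<alpha> = ereal a" "\<beta> = ereal b"
    by (cases \<alpha>; cases \<beta>) auto
  ultimately show "let a = real_of_ereal \<alpha>;
           b = real_of_ereal \<beta>;
           \<theta> = (b - a) / (b * (1 - a))
       in mu_sub \<epsilon> \<beta> D =
          ereal (max 0 (b / (1 - b) * (\<theta> * log 2 (1 / \<epsilon>) - h2 \<theta>)))"
    using assms unfolding Let_def ab by (simp add: mu_sub_lt_1)
qed

end
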